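(* Every retract of a hyper-median partial cube is a hyper-median partial cube.
   Context: Graphs are simple, undirected, possibly infinite. In a connected graph $G$, $I_G(x,y)$ is the set of vertices on shortest $(x,y)$-paths; $A$ is convex if $I_G(x,y)\subseteq A$ for all $x,y\in A$; $co_G$ is the convex hull and $\mathcal{I}_G(A)=\bigcup_{x,y\in A}I_G(x,y)$. A partial cube is an isometric subgraph of a (possibly infinite) hypercube. A copoint at $x$ is a convex set maximal with respect to not containing $x$; $ph(G)$ is the least $n$ with $co_G(C\cup\{x\})=\mathcal{I}^n_G(C\cup\{x\})$ for all $x$ and copoints $C$ at $x$. A Peano partial cube is a partial cube all of whose finite convex subgraphs have pre-hull number at most $1$. A hypertorus is a Cartesian product of finitely many even cycles, at least one of length greater than $4$. Median of $(u,v,w)$: a vertex of $I(u,v)\cap I(v,w)\cap I(w,u)$; metric triangle: $(u,v,w)$ with $I(u,v)\cap I(u,w)=\{u\}$, $I(v,u)\cap I(v,w)=\{v\}$, $I(w,u)\cap I(w,v)=\{w\}$; quasi-median of $(u,v,w)$: a metric triangle $(x,y,z)$ with $d(u,v)=d(u,x)+d(x,y)+d(y,v)$, $d(v,w)=d(v,y)+d(y,z)+d(z,w)$, $d(w,u)=d(w,z)+d(z,x)+d(x,u)$; hyper-median: a quasi-median $(x,y,z)$ with $G[co_G(\{x,y,z\})]$ a hypertorus. A hyper-median partial cube is a Peano partial cube in which every triple of vertices has a median or a hyper-median. A retraction of $G$ onto an induced subgraph $H$ is a map $f:V(G)\to V(H)$ with $d_H(f(x),f(y))\le d_G(x,y)$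 for all $x,y$ and $f$ the identity on $V(H)$; $H$ is a retract. *)

theory Defs
  imports Main "HOL-Library.Extended_Nat"
begin

definition graph :: "'a set \<Rightarrow> ('a \<Rightarrow> 'a \<Rightarrow> bool) \<Rightarrow> bool" where
  "graph V E \<longleftrightarrow> (\<forall>x y. E x y \<longrightarrow> E y x \<and> x \<noteq> y \<and> x \<in> V \<and> y \<in> V)"

definition induced :: "('a \<Rightarrow> 'a \<Rightarrow> bool) \<Rightarrow> 'a set \<Rightarrow> 'a \<Rightarrow> 'a \<Rightarrow> bool" where
  "induced E A = (\<lambda>x y. E x y \<and> x \<in> A \<and> y \<in> A)"

definition walk :: "'a set \<Rightarrow> ('a \<Rightarrow> 'a \<Rightarrow> bool) \<Rightarrow> 'a list \<Rightarrow> bool" where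
  "walk V E p \<longleftrightarrow> p \<noteq> [] \<and> set p \<subseteq> V \<and> (\<forall>i. Suc i < length p \<longrightarrow> E (p ! i) (p ! Suc i))"

(* graph distance; infinity if no path *)
definition gdist :: "'a set \<Rightarrow> ('a \<Rightarrow> 'a \<Rightarrow> bool) \<Rightarrow> 'a \<Rightarrow> 'a \<Rightarrow> enat" where
  "gdist V E x y = (INF p \<in> {p. walk V E p \<and> hd p = x \<and> last p = y}. enat (length p - 1))"

definition connected_graph :: "'a set \<Rightarrow> ('a \<Rightarrow> 'a \<Rightarrow> bool) \<Rightarrow> bool" where
  "connected_graph V E \<longleftrightarrow> graph V E \<and> (\<forall>x\<in>V. \<forall>y\<in>V. gdist V E x y < \<infinity>)"

definition interval :: "'a set \<Rightarrow> ('a \<Rightarrow> 'a \<Rightarrow> bool) \<Rightarrow> 'a \<Rightarrow> 'a \<Rightarrow> 'a set" where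
  "interval V E x y = {z \<in> V. gdist V E x z + gdist V E z y = gdist V E x y}"

definition convex :: "'a set \<Rightarrow> ('a \<Rightarrow> 'a \<Rightarrow> bool) \<Rightarrow> 'a set \<Rightarrow> bool" where
  "convex V E A \<longleftrightarrow> A \<subseteq> V \<and> (\<forall>x\<in>A. \<forall>y\<in>A. interval V E x y \<subseteq> A)"

definition co :: "'a set \<Rightarrow> ('a \<Rightarrow> 'a \<Rightarrow> bool) \<Rightarrow> 'a set \<Rightarrow> 'a set" where
  "co V E A = \<Inter> {C. convex V E C \<and> A \<subseteq> C}"

definition Iset :: "'a set \<Rightarrow> ('a \<Rightarrow> 'a \<Rightarrow> bool) \<Rightarrow> 'a set \<Rightarrow> 'a set" where
  "Iset V E A = (\<Union>x\<in>A. \<Union>y\<in>A. interval V E x y)"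

definition copoint :: "'a set \<Rightarrow> ('a \<Rightarrow> 'a \<Rightarrow> bool) \<Rightarrow> 'a \<Rightarrow> 'a set \<Rightarrow> bool" where
  "copoint V E x C \<longleftrightarrow> x \<in> V \<and> convex V E C \<and> x \<notin> C \<and>
     (\<forall>D. convex V E D \<and> x \<notin> D \<and> C \<subseteq> D \<longrightarrow> D = C)"

definition ph_le :: "'a set \<Rightarrow> ('a \<Rightarrow> 'a \<Rightarrow> bool) \<Rightarrow> nat \<Rightarrow> bool" where
  "ph_le V E n \<longleftrightarrow> (\<exists>m\<le>n. \<forall>x C. copoint V E x C \<longrightarrow>
      co V E (C \<union> {x}) = (Iset V E ^^ m) (C \<union> {x}))"

(* isometric subgraph of a (possibly infinite) hypercube: vertices of the hypercube on
   index set I are subsets of I, two being adjacent iff their symmetric difference has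
   one element; the distance is the size of the symmetric difference.  The index set
   is taken inside the type of vertex pairs (enough: coordinates used inject into edges). *)
definition partial_cube :: "'a set \<Rightarrow> ('a \<Rightarrow> 'a \<Rightarrow> bool) \<Rightarrow> bool" where
  "partial_cube V E \<longleftrightarrow> graph V E \<and>
     (\<exists>f :: 'a \<Rightarrow> ('a \<times> 'a) set. \<forall>x\<in>V. \<forall>y\<in>V.
        finite (f x - f y \<union> (f y - f x)) \<and>
        gdist V E x y = enat (card (f x - f y \<union> (f y - f x))))"

definition peano_partial_cube :: "'a set \<Rightarrow> ('a \<Rightarrow> 'a \<Rightarrow> bool) \<Rightarrow> bool" where
  "peano_partial_cube V E \<longleftrightarrow> partial_cube V E \<and>
     (\<forall>A. finite A \<and> convex V E A \<longrightarrow> ph_le A (induced E A) 1)"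

definition is_median :: "'a set \<Rightarrow> ('a \<Rightarrow> 'a \<Rightarrow> bool) \<Rightarrow> 'a \<Rightarrow> 'a \<Rightarrow> 'a \<Rightarrow> 'a \<Rightarrow> bool" where
  "is_median V E u v w m \<longleftrightarrow>
     m \<in> interval V E u v \<inter> interval V E v w \<inter> interval V E w u"

definition metric_triangle :: "'a set \<Rightarrow> ('a \<Rightarrow> 'a \<Rightarrow> bool) \<Rightarrow> 'a \<Rightarrow> 'a \<Rightarrow> 'a \<Rightarrow> bool" where
  "metric_triangle V E u v w \<longleftrightarrow> u \<in> V \<and> v \<in> V \<and> w \<in> V \<and>
     interval V E u v \<inter> interval V E u w = {u} \<and>
     interval V E v u \<inter> interval V E v w = {v} \<and>
     interval V E w u \<inter> interval V E w v = {w}"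

definition quasi_median ::
  "'a set \<Rightarrow> ('a \<Rightarrow> 'a \<Rightarrow> bool) \<Rightarrow> 'a \<Rightarrow> 'a \<Rightarrow> 'a \<Rightarrow> 'a \<Rightarrow> 'a \<Rightarrow> 'a \<Rightarrow> bool" where
  "quasi_median V E u v w x y z \<longleftrightarrow> metric_triangle V E x y z \<and>
     gdist V E u v = gdist V E u x + gdist V E x y + gdist V E y v \<and>
     gdist V E v w = gdist V E v y + gdist V E y z + gdist V E z w \<and>
     gdist V E w u = gdist V E w z + gdist V E z x + gdist V E x u"

definition torus_verts :: "nat list \<Rightarrow> nat list set" where
  "torus_verts ns = {xs. length xs = length ns \<and> (\<forall>i<length ns. xs ! i < ns ! i)}"

definition torus_adj :: "nat list \<Rightarrow> nat list \<Rightarrow> nat list \<Rightarrow> bool" where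
  "torus_adj ns xs ys \<longleftrightarrow> (\<exists>i<length ns. (\<forall>j<length ns. j \<noteq> i \<longrightarrow> xs ! j = ys ! j) \<and>
      (ys ! i = Suc (xs ! i) mod (ns ! i) \<or> xs ! i = Suc (ys ! i) mod (ns ! i)))"

definition hypertorus :: "'a set \<Rightarrow> ('a \<Rightarrow> 'a \<Rightarrow> bool) \<Rightarrow> bool" where
  "hypertorus V E \<longleftrightarrow> graph V E \<and> (\<exists>ns. ns \<noteq> [] \<and> (\<forall>n\<in>set ns. even n \<and> n \<ge> 4) \<and>
     (\<exists>n\<in>set ns. n > 4) \<and>
     (\<exists>\<phi>. bij_betw \<phi> V (torus_verts ns) \<and>
        (\<forall>x\<in>V. \<forall>y\<in>V. E x y \<longleftrightarrow> torus_adj ns (\<phi> x) (\<phi> y))))"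

definition hyper_median ::
  "'a set \<Rightarrow> ('a \<Rightarrow> 'a \<Rightarrow> bool) \<Rightarrow> 'a \<Rightarrow> 'a \<Rightarrow> 'a \<Rightarrow> 'a \<Rightarrow> 'a \<Rightarrow> 'a \<Rightarrow> bool" where
  "hyper_median V E u v w x y z \<longleftrightarrow> quasi_median V E u v w x y z \<and>
     hypertorus (co V E {x, y, z}) (induced E (co V E {x, y, z}))"

definition hyper_median_partial_cube :: "'a set \<Rightarrow> ('a \<Rightarrow> 'a \<Rightarrow> bool) \<Rightarrow> bool" where
  "hyper_median_partial_cube V E \<longleftrightarrow> peano_partial_cube V E \<and>
     (\<forall>u\<in>V. \<forall>v\<in>V. \<forall>w\<in>V. (\<exists>m. is_median V E u v w m) \<or>
        (\<exists>x y z. hyper_median V E u v w x y z))"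

definition retraction :: "'a set \<Rightarrow> ('a \<Rightarrow> 'a \<Rightarrow> bool) \<Rightarrow> 'a set \<Rightarrow> ('a \<Rightarrow> 'a) \<Rightarrow> bool" where
  "retraction V E W f \<longleftrightarrow> W \<subseteq> V \<and> (\<forall>x\<in>V. f x \<in> W) \<and> (\<forall>x\<in>W. f x = x) \<and>
     (\<forall>x\<in>V. \<forall>y\<in>V. gdist W (induced E W) (f x) (f y) \<le> gdist V E x y)"

definition retract :: "'a set \<Rightarrow> ('a \<Rightarrow> 'a \<Rightarrow> bool) \<Rightarrow> 'a set \<Rightarrow> bool" where
  "retract V E W \<longleftrightarrow> (\<exists>f. retraction V E W f)"

end

(* Embed V isometrically into a hypercube; everything metric then becomes a statement
about single coordinates.

(1) In a partial cube whose finite convex subgraphs have pre-hull number at most 1, every finite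
antipodal convex set T is gated.

(2) If every triple of a partial cube has a median or a quasi-median (x, y, z) in a gated antipodal
set T crossed only by coordinates on which x, y, z disagree, then the Peano axiom holds, so segments
from a point to a convex set form a convex set and all pre-hull numbers are at most 1.

(3) Let (u, v, w) be a triple of the retract W without a median. Among the triples of W satisfying
the quasi-median equations take (x, y, z) of least perimeter; it is its own hyper-median in the big
graph. It remains to see that the hypertorus T spanned by x, y, z lies in W. The retraction followed
by the gate map of T is a nonexpansive self-map g of the torus T fixing x, y, z. Moving x along a
shortest factor shows that g fixes a whole cycle through x; such a cycle propagates to all fixed
points, so that this factor can be split off, and by induction on the number of factors g is the
identity. *)

theory Submission
  imports Defs
begin

text \<open>A set that is convex in the retract \<open>W\<close> need not be convex in
  \<open>V\<close>, so the pre-hull condition on \<open>V\<close> does not simply restrict to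
  \<open>W\<close>. Gatedness does pass down: for a set inside \<open>W\<close>, the gate condition
  in \<open>W\<close> asks for gates of fewer points. Hence the pre-hull condition on
  \<open>V\<close> serves only to produce gates, and the pre-hull numbers of \<open>W\<close> are
  recovered from its triples.

  A retraction visibly preserves the quasi-median equations, but not metric triangles or hulls; a
  triple of least perimeter replaces the image of a hyper-median for this reason. The self-map g of
  the torus is not known to be idempotent, since the gate of a point of \<open>W\<close> may a
  priori lie outside \<open>W\<close>. Its fixed points are therefore enlarged cycle by cycle.
  Squares cannot be factors, because three distinct points of a 4-cycle never form a metric
  triangle, and length at least 6 is what lets a fixed cycle propagate to its neighbours.\<close>

section \<open>Partial cubes\<close>

lemma gdist_le:
  assumes "walk V E p"
  shows "gdist V E (hd p) (last p) \<le> enat (length p - 1)"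
  unfolding gdist_def using assms by (intro INF_lower) auto

lemma gdist_attained:
  assumes "gdist V E x y = enat n"
  obtains p where "walk V E p" "hd p = x" "last p = y" "length p = Suc n"
proof -
  let ?P = "{p. walk V E p \<and> hd p = x \<and> last p = y}"
  let ?A = "(\<lambda>p. enat (length p - 1)) ` ?P"
  have I: "Inf ?A = enat n" using assms unfolding gdist_def by simp
  have "?A \<noteq> {}"
  proof
    assume "?A = {}"
    then have "Inf ?A = \<infinity>" unfolding Inf_enat_def by simp
    with I show False by simp
  qed
  then have "Inf ?A \<in> ?A" unfolding Inf_enat_def by (auto intro: LeastI)
  then obtain p where p: "p \<in> ?P" "enat n = enat (length p - 1)" using I by auto
  have "p \<noteq> []" using p unfolding walk_def by auto
  with p have "length p = Suc n" by (cases p) auto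
  with p that show thesis by auto
qed

lemma walk_Cons:
  "walk V E (x # p) \<longleftrightarrow> x \<in> V \<and> (p = [] \<or> E x (hd p) \<and> walk V E p)"
proof (cases p)
  case Nil
  then show ?thesis by (simp add: walk_def)
next
  case (Cons y q)
  then show ?thesis
    unfolding walk_def by (force simp: nth_Cons less_Suc_eq_0_disj split: nat.splits)
qed

text \<open>\<open>D\<close> is a potential: it drops by at most one along an edge, which bounds
  every walk to \<open>y\<close> from below, and away from \<open>y\<close> some edge makes it drop
  by exactly one, so descending yields a walk of length \<open>D x\<close>. The same criterion
  computes distances in convex subgraphs and in tori.\<close>

lemma gdist_eqI:
  assumes y: "y \<in> S" "D y = 0"
    and lip: "\<And>u v. R u v \<Longrightarrow> u \<in> S \<Longrightarrow> v \<in> S \<Longrightarrow> D u \<le> Suc (D v)"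
    and step: "\<And>u. u \<in> S \<Longrightarrow> u \<noteq> y \<Longrightarrow> \<exists>v\<in>S. R u v \<and> D u = Suc (D v)"
    and x: "x \<in> S"
  shows "gdist S R x y = enat (D x)"
proof (rule antisym)
  have "\<exists>p. walk S R p \<and> hd p = u \<and> last p = y \<and> length p = Suc (D u)" if "u \<in> S" for u
    using that
  proof (induction "D u" arbitrary: u)
    case 0
    then have "u = y" using step by force
    with 0 show ?case by (intro exI[of _ "[y]"]) (auto simp: walk_Cons)
  next
    case (Suc n)
    then have "u \<noteq> y" using y by auto
    with step Suc obtain v where v: "v \<in> S" "R u v" "D u = Suc (D v)" by blast
    with Suc obtain p where p: "walk S R p" "hd p = v" "last p = y" "length p = Suc (D v)" by force
    then have "p \<noteq> []" by auto
    with p v Suc show ?case by (intro exI[of _ "u # p"]) (auto simp: walk_Cons)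
  qed
  from this[OF x] obtain p where "walk S R p" "hd p = x" "last p = y" "length p = Suc (D x)" by blast
  with gdist_le[of S R p] show "gdist S R x y \<le> enat (D x)" by simp
next
  have "D (hd p) \<le> length p - 1" if "walk S R p" "last p = y" for p
    using that
  proof (induction p)
    case Nil
    then show ?case by (simp add: walk_def)
  next
    case (Cons u q)
    show ?case
    proof (cases "q = []")
      case True
      with Cons y show ?thesis by simp
    next
      case False
      with Cons have w: "walk S R q" "R u (hd q)" "u \<in> S" by (auto simp: walk_Cons)
      have "hd q \<in> S" using w False unfolding walk_def by auto
      with lip w have "D u \<le> Suc (D (hd q))" by blast
      with Cons False w show ?thesis by (cases q) auto
    qed
  qed
  then show "enat (D x) \<le> gdist S R x y"
    unfolding gdist_def by (auto intro!: INF_greatest)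
qed

lemma gdist_mono:
  assumes "W \<subseteq> V"
  shows "gdist V E x y \<le> gdist W (induced E W) x y"
  unfolding gdist_def
  by (rule INF_superset_mono) (use assms in \<open>auto simp: walk_def induced_def\<close>)

section \<open>Hypercube coordinates\<close>

definition symdiff :: "'b set \<Rightarrow> 'b set \<Rightarrow> 'b set" where
  "symdiff A B = A - B \<union> (B - A)"

lemma symdiff_iff: "e \<in> symdiff A B \<longleftrightarrow> (e \<in> A) \<noteq> (e \<in> B)"
  by (auto simp: symdiff_def)

text \<open>The triangle inequality with its defect: a coordinate flipped on the way to
  \<open>C\<close> and flipped back afterwards is counted twice. Betweenness is the vanishing of
  this defect.\<close>

lemma card_symdiff_add:
  assumes "finite (symdiff A C)" "finite (symdiff C B)"
  shows "card (symdiff A C) + card (symdiff C B) = card (symdiff A B) + 2 * card (symdiff A C \<inter> symdiff C B)"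
proof -
  have "symdiff A B = (symdiff A C \<union> symdiff C B) - (symdiff A C \<inter> symdiff C B)" by (auto simp: symdiff_def)
  then have "card (symdiff A B) = card (symdiff A C \<union> symdiff C B) - card (symdiff A C \<inter> symdiff C B)"
    using assms by (simp add: card_Diff_subset le_infI1)
  moreover have "card (symdiff A C \<inter> symdiff C B) \<le> card (symdiff A C \<union> symdiff C B)"
    using assms by (intro card_mono) auto
  ultimately show ?thesis using card_Un_Int[OF assms] by linarith
qed

text \<open>The embedding \<open>\<psi>\<close> is a parameter, so convex subsets and retracts
  interpret the locale with the same \<open>\<psi>\<close>. Notions built from \<open>\<psi>\<close>
  alone, such as \<open>hdist\<close>, \<open>btw\<close>, \<open>crosses\<close> and
  \<open>antipodal\<close>, are then literally the same in \<open>V\<close> and in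
  \<open>W\<close>.\<close>

locale pcube =
  fixes V :: "'a set" and E :: "'a \<Rightarrow> 'a \<Rightarrow> bool" and \<psi> :: "'a \<Rightarrow> 'b set"
  assumes gr: "graph V E"
    and fin: "x \<in> V \<Longrightarrow> y \<in> V \<Longrightarrow> finite (symdiff (\<psi> x) (\<psi> y))"
    and gd: "x \<in> V \<Longrightarrow> y \<in> V \<Longrightarrow> gdist V E x y = enat (card (symdiff (\<psi> x) (\<psi> y)))"
begin

definition hdist :: "'a \<Rightarrow> 'a \<Rightarrow> nat" where
  "hdist x y = card (symdiff (\<psi> x) (\<psi> y))"

definition btw :: "'a \<Rightarrow> 'a \<Rightarrow> 'a \<Rightarrow> bool" where
  "btw x z y \<longleftrightarrow> (\<forall>e. (e \<in> \<psi> x \<longleftrightarrow> e \<in> \<psi> y) \<longrightarrow> (e \<in> \<psi> z \<longleftrightarrow> e \<in> \<psi> x))"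

lemma gdist_hdist: "x \<in> V \<Longrightarrow> y \<in> V \<Longrightarrow> gdist V E x y = enat (hdist x y)"
  using gd by (simp add: hdist_def)

lemma hdist_self [simp]: "hdist x x = 0"
  by (simp add: hdist_def symdiff_def)

lemma hdist_triangle: "x \<in> V \<Longrightarrow> y \<in> V \<Longrightarrow> z \<in> V \<Longrightarrow> hdist x y \<le> hdist x z + hdist z y"
  using card_symdiff_add[of "\<psi> x" "\<psi> z" "\<psi> y"] fin by (simp add: hdist_def)

lemma btw_iff_hdist:
  assumes "x \<in> V" "y \<in> V" "z \<in> V"
  shows "btw x z y \<longleftrightarrow> hdist x z + hdist z y = hdist x y"
proof -
  have "btw x z y \<longleftrightarrow> symdiff (\<psi> x) (\<psi> z) \<inter> symdiff (\<psi> z) (\<psi> y) = {}"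
    unfolding btw_def by (auto simp: symdiff_def)
  also have "\<dots> \<longleftrightarrow> card (symdiff (\<psi> x) (\<psi> z) \<inter> symdiff (\<psi> z) (\<psi> y)) = 0"
    using fin assms by simp
  finally show ?thesis
    using card_symdiff_add[of "\<psi> x" "\<psi> z" "\<psi> y"] fin assms by (simp add: hdist_def)
qed

lemma btw_commute: "btw x z y \<longleftrightarrow> btw y z x"
  unfolding btw_def by blast

lemma interval_btw:
  assumes "x \<in> V" "y \<in> V"
  shows "interval V E x y = {z \<in> V. btw x z y}"
  unfolding interval_def using assms by (auto simp: gdist_hdist btw_iff_hdist)

text \<open>Injectivity of \<open>\<psi>\<close> comes from here: distance 0 is attained by a walk,
  and that walk has a single vertex.\<close>

lemma hdist_eq_0:
  assumes "x \<in> V" "y \<in> V"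
  shows "hdist x y = 0 \<longleftrightarrow> x = y"
proof
  assume "hdist x y = 0"
  then have "gdist V E x y = enat 0" using assms by (simp add: gdist_hdist)
  then obtain p where "hd p = x" "last p = y" "length p = Suc 0" by (rule gdist_attained)
  then show "x = y" by (cases p) auto
qed simp

lemma psi_inj: "x \<in> V \<Longrightarrow> y \<in> V \<Longrightarrow> \<psi> x = \<psi> y \<Longrightarrow> x = y"
  by (metis hdist_def hdist_eq_0 hdist_self)

lemma edge_hdist: "E x y \<longleftrightarrow> x \<in> V \<and> y \<in> V \<and> hdist x y = 1"
proof
  assume e: "E x y"
  then have v: "x \<in> V" "y \<in> V" "x \<noteq> y" using gr by (auto simp: graph_def)
  have "walk V E [x, y]" using e v by (simp add: walk_Cons)
  from gdist_le[OF this] v have "hdist x y \<le> 1" by (simp add: gdist_hdist one_enat_def)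
  moreover have "hdist x y \<noteq> 0" using v hdist_eq_0 by simp
  ultimately show "x \<in> V \<and> y \<in> V \<and> hdist x y = 1" using v by simp
next
  assume "x \<in> V \<and> y \<in> V \<and> hdist x y = 1"
  then have "gdist V E x y = enat 1" by (simp add: gdist_hdist)
  then obtain p where p: "walk V E p" "hd p = x" "last p = y" "length p = Suc 1"
    by (rule gdist_attained)
  then obtain a b where "p = [a, b]" by (auto simp: length_Suc_conv)
  with p show "E x y" by (auto simp: walk_Cons)
qed

lemma geodesic_step:
  assumes "x \<in> V" "y \<in> V" "x \<noteq> y"
  obtains x1 where "E x x1" "x1 \<in> V" "hdist x y = Suc (hdist x1 y)" "btw x x1 y"
proof -
  have "gdist V E x y = enat (hdist x y)" using assms by (simp add: gdist_hdist)
  then obtain p where p: "walk V E p" "hd p = x" "last p = y" "length p = Suc (hdist x y)"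
    by (rule gdist_attained)
  moreover have "hdist x y \<noteq> 0" using assms hdist_eq_0 by simp
  ultimately obtain x1 q where q: "p = x # x1 # q"
    by (cases p; cases "tl p") auto
  with p have w: "walk V E (x1 # q)" and e: "E x x1" by (auto simp: walk_Cons)
  have x1: "x1 \<in> V" "hdist x x1 = 1" using e edge_hdist by auto
  have "hdist x1 y \<le> length q" using gdist_le[OF w] q p x1 assms by (simp add: gdist_hdist)
  then have "hdist x1 y < hdist x y" using q p by simp
  moreover have "hdist x y \<le> hdist x x1 + hdist x1 y" using assms x1 by (intro hdist_triangle)
  ultimately have d: "hdist x y = Suc (hdist x1 y)" using x1 by simp
  then have "btw x x1 y" using btw_iff_hdist assms x1 by simp
  with that e x1 d show thesis by blast
qed

lemma edge_coordinate:
  assumes "E x y"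
  shows "\<exists>e. \<forall>e'. (e' \<in> \<psi> x \<longleftrightarrow> e' \<in> \<psi> y) \<longleftrightarrow> e' \<noteq> e"
proof -
  have "card (symdiff (\<psi> x) (\<psi> y)) = 1" using assms edge_hdist by (simp add: hdist_def)
  then obtain e where "symdiff (\<psi> x) (\<psi> y) = {e}" by (auto simp: card_1_singleton_iff)
  then have "(e' \<in> \<psi> x \<longleftrightarrow> e' \<in> \<psi> y) \<longleftrightarrow> e' \<noteq> e" for e'
    using symdiff_iff[of e' "\<psi> x" "\<psi> y"] by auto
  then show ?thesis by blast
qed

lemma isometric_restrict:
  assumes "S \<subseteq> V"
    and "\<And>x y. x \<in> S \<Longrightarrow> y \<in> S \<Longrightarrow> gdist S (induced E S) x y = gdist V E x y"
  shows "pcube S (induced E S) \<psi>"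
proof
  show "graph S (induced E S)" using gr by (auto simp: graph_def induced_def)
qed (use assms gd fin in \<open>auto simp: subset_eq\<close>)

lemma convex_btw:
  "convex V E C \<longleftrightarrow> C \<subseteq> V \<and> (\<forall>x\<in>C. \<forall>y\<in>C. \<forall>z\<in>V. btw x z y \<longrightarrow> z \<in> C)"
proof (cases "C \<subseteq> V")
  case True
  then have "interval V E x y = {z \<in> V. btw x z y}" if "x \<in> C" "y \<in> C" for x y
    using that by (intro interval_btw) auto
  then show ?thesis unfolding convex_def by blast
qed (simp add: convex_def)

text \<open>The first step of a geodesic between two points of \<open>A\<close> stays in
  \<open>A\<close>, so \<open>hdist\<close> satisfies the descent criterion inside
  \<open>A\<close>.\<close>

lemma restrict_convex:
  assumes "convex V E A"
  shows "pcube A (induced E A) \<psi>"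
proof (rule isometric_restrict)
  show A: "A \<subseteq> V" using assms by (simp add: convex_def)
  fix x y assume xy: "x \<in> A" "y \<in> A"
  have "gdist A (induced E A) x y = enat (hdist x y)"
  proof (rule gdist_eqI[where D = "\<lambda>u. hdist u y"])
    fix u v assume "induced E A u v" "u \<in> A" "v \<in> A"
    then have "u \<in> V" "y \<in> V" "v \<in> V" "hdist u v = 1"
      using A xy edge_hdist[of u v] by (auto simp: induced_def)
    then show "hdist u y \<le> Suc (hdist v y)" using hdist_triangle[of u y v] by simp
  next
    fix u assume u: "u \<in> A" "u \<noteq> y"
    then have uy: "u \<in> V" "y \<in> V" "u \<noteq> y" using A xy by auto
    obtain v where v: "E u v" "v \<in> V" "hdist u y = Suc (hdist v y)" "btw u v y"
      by (rule geodesic_step[OF uy])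
    have "v \<in> A" using u(1) xy(2) v(2,4) assms unfolding convex_btw by blast
    with v u show "\<exists>v\<in>A. induced E A u v \<and> hdist u y = Suc (hdist v y)" by (auto simp: induced_def)
  qed (use xy in auto)
  moreover have "x \<in> V" "y \<in> V" using A xy by auto
  ultimately show "gdist A (induced E A) x y = gdist V E x y" by (simp add: gdist_hdist)
qed

text \<open>A convex set is the intersection of the half-spaces containing it.\<close>

lemma convex_memI:
  assumes C: "convex V E C" "C \<noteq> {}" and v: "v \<in> V"
    and agree: "\<And>e s. \<forall>c\<in>C. \<forall>c'\<in>C. (e \<in> \<psi> c \<longleftrightarrow> e \<in> \<psi> c') \<Longrightarrow> s \<in> C \<Longrightarrow> (e \<in> \<psi> v \<longleftrightarrow> e \<in> \<psi> s)"
  shows "v \<in> C"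
proof (rule ccontr)
  assume nv: "v \<notin> C"
  obtain c where c: "c \<in> C" "\<And>d. d \<in> C \<Longrightarrow> hdist c v \<le> hdist d v"
    using ex_has_least_nat[of "\<lambda>c. c \<in> C" _ "\<lambda>c. hdist c v"] C(2) by (meson ex_in_conv)
  have cV: "C \<subseteq> V" using C by (simp add: convex_def)
  then have cv: "c \<in> V" "v \<in> V" "c \<noteq> v" using c nv v by auto
  obtain c1 where c1: "E c c1" "c1 \<in> V" "hdist c v = Suc (hdist c1 v)" "btw c c1 v"
    by (rule geodesic_step[OF cv])
  have nc1: "c1 \<notin> C" using c c1 by fastforce
  obtain e where e: "\<forall>e'. (e' \<in> \<psi> c \<longleftrightarrow> e' \<in> \<psi> c1) \<longleftrightarrow> e' \<noteq> e"
    using edge_coordinate[OF c1(1)] by (rule exE)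
  \<comment> \<open>The coordinate \<open>e\<close> of the edge leaving \<open>C\<close> at the
    nearest point \<open>c\<close> is constant on \<open>C\<close>: a point \<open>d\<close> across
    \<open>e\<close> would put \<open>c1\<close> between \<open>c\<close> and
    \<open>d\<close>.\<close>
  have "(e \<in> \<psi> d \<longleftrightarrow> e \<in> \<psi> c)" if d: "d \<in> C" for d
  proof (rule ccontr)
    assume "\<not> (e \<in> \<psi> d \<longleftrightarrow> e \<in> \<psi> c)"
    then have "btw c c1 d" unfolding btw_def using e by blast
    with C(1) c(1) d c1(2) nc1 show False unfolding convex_btw by blast
  qed
  with agree[of e c] c have "e \<in> \<psi> v \<longleftrightarrow> e \<in> \<psi> c" by blast
  with c1(4) e show False unfolding btw_def by blast
qed

lemma separating_edge:
  assumes "x \<in> V" "y \<in> V" "(e \<in> \<psi> x) \<noteq> (e \<in> \<psi> y)"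
  obtains a b where "E a b" "btw x a y" "btw x b y" "e \<in> \<psi> a \<longleftrightarrow> e \<in> \<psi> x" "e \<in> \<psi> b \<longleftrightarrow> e \<in> \<psi> y"
proof -
  have "\<exists>a b. E a b \<and> btw x a y \<and> btw x b y \<and> (e \<in> \<psi> a \<longleftrightarrow> e \<in> \<psi> x) \<and> (e \<in> \<psi> b \<longleftrightarrow> e \<in> \<psi> y)"
    using assms(1,3)
  proof (induction "hdist x y" arbitrary: x)
    case 0
    then show ?case using hdist_eq_0 assms(2) by auto
  next
    case (Suc n)
    then have xy: "x \<in> V" "y \<in> V" "x \<noteq> y" using assms(2) by auto
    obtain x1 where x1: "E x x1" "x1 \<in> V" "hdist x y = Suc (hdist x1 y)" "btw x x1 y"
      by (rule geodesic_step[OF xy])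
    show ?case
    proof (cases "e \<in> \<psi> x1 \<longleftrightarrow> e \<in> \<psi> y")
      case True
      have "btw x x y" by (simp add: btw_def)
      with True x1 show ?thesis by blast
    next
      case False
      have n: "n = hdist x1 y" using x1(3) Suc.hyps(2) by simp
      obtain a b where ab: "E a b" "btw x1 a y" "btw x1 b y"
        "e \<in> \<psi> a \<longleftrightarrow> e \<in> \<psi> x1" "e \<in> \<psi> b \<longleftrightarrow> e \<in> \<psi> y"
        using Suc.hyps(1)[OF n x1(2) False] by blast
      have "btw x a y" "btw x b y" using ab(2,3) x1(4) unfolding btw_def by blast+
      moreover have "e \<in> \<psi> a \<longleftrightarrow> e \<in> \<psi> x" using ab(4) False Suc.prems by blast
      ultimately show ?thesis using ab by blast
    qed
  qed
  with that show thesis by blast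
qed

subsection \<open>Gates of antipodal convex sets\<close>

definition crosses :: "'a set \<Rightarrow> 'b \<Rightarrow> bool" where
  "crosses T e \<longleftrightarrow> (\<exists>s\<in>T. \<exists>t\<in>T. (e \<in> \<psi> s) \<noteq> (e \<in> \<psi> t))"

definition antipodal :: "'a set \<Rightarrow> bool" where
  "antipodal T \<longleftrightarrow> (\<forall>t\<in>T. \<exists>t'\<in>T. \<forall>s\<in>T. btw t s t')"

definition gated :: "'a set \<Rightarrow> bool" where
  "gated T \<longleftrightarrow> (\<forall>u\<in>V. \<exists>p\<in>T. \<forall>t\<in>T. btw u p t)"

lemma not_crosses: "\<not> crosses T e \<Longrightarrow> s \<in> T \<Longrightarrow> t \<in> T \<Longrightarrow> e \<in> \<psi> s \<longleftrightarrow> e \<in> \<psi> t"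
  unfolding crosses_def by blast

text \<open>For a crossed \<open>e\<close>, \<open>T\<close> has a point on the side of
  \<open>u\<close>, and the gate lies between \<open>u\<close> and it. Uncrossed coordinates are
  constant on \<open>T\<close>, so they impose nothing. A gate is thus the point of \<open>T\<close>
  copying \<open>u\<close> on all crossed coordinates.\<close>

lemma gate_iff:
  assumes "p \<in> T"
  shows "(\<forall>t\<in>T. btw u p t) \<longleftrightarrow> (\<forall>e. crosses T e \<longrightarrow> (e \<in> \<psi> p \<longleftrightarrow> e \<in> \<psi> u))"
    (is "?L \<longleftrightarrow> ?R")
proof
  assume L: ?L
  show ?R
  proof (intro allI impI)
    fix e assume "crosses T e"
    then obtain t where "t \<in> T" "e \<in> \<psi> t \<longleftrightarrow> e \<in> \<psi> u" unfolding crosses_def by blast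
    with L show "e \<in> \<psi> p \<longleftrightarrow> e \<in> \<psi> u" unfolding btw_def by blast
  qed
next
  assume R: ?R
  show ?L
  proof
    fix t assume t: "t \<in> T"
    have "e \<in> \<psi> p \<longleftrightarrow> e \<in> \<psi> u" if "e \<in> \<psi> u \<longleftrightarrow> e \<in> \<psi> t" for e
    proof (cases "crosses T e")
      case True
      with R show ?thesis by blast
    next
      case False
      with not_crosses[OF False assms t] that show ?thesis by blast
    qed
    then show "btw u p t" by (simp add: btw_def)
  qed
qed

lemma antipode:
  assumes "antipodal T" "t \<in> T"
  shows "\<exists>t'\<in>T. (\<forall>s\<in>T. btw t s t') \<and> (\<forall>e. crosses T e \<longrightarrow> (e \<in> \<psi> t') \<noteq> (e \<in> \<psi> t))"
proof -
  obtain t' where t': "t' \<in> T" "\<forall>s\<in>T. btw t s t'" using assms unfolding antipodal_def by blast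
  have "(e \<in> \<psi> t') \<noteq> (e \<in> \<psi> t)" if "crosses T e" for e
  proof
    assume "(e \<in> \<psi> t') = (e \<in> \<psi> t)"
    then have "\<forall>s\<in>T. (e \<in> \<psi> s) = (e \<in> \<psi> t)" using t'(2) unfolding btw_def by blast
    with that show False unfolding crosses_def by blast
  qed
  with t' show ?thesis by blast
qed

lemma convex_agree_memI:
  assumes "convex V E T" "s \<in> T" "v \<in> V" "\<And>e. \<not> crosses T e \<Longrightarrow> e \<in> \<psi> v \<longleftrightarrow> e \<in> \<psi> s"
  shows "v \<in> T"
proof (rule convex_memI[OF assms(1) _ assms(3)])
  show "T \<noteq> {}" using assms(2) by blast
  fix e s' assume c: "\<forall>c\<in>T. \<forall>c'\<in>T. (e \<in> \<psi> c \<longleftrightarrow> e \<in> \<psi> c')" "s' \<in> T"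
  then have n: "\<not> crosses T e" unfolding crosses_def by blast
  show "e \<in> \<psi> v \<longleftrightarrow> e \<in> \<psi> s'" using assms(4)[OF n] not_crosses[OF n c(2) assms(2)] by simp
qed

text \<open>The set is the intersection of the half-spaces containing \<open>T\<close> and
  \<open>b\<close>. Each member is determined by its symmetric difference with \<open>b\<close>, a
  subset of one finite union.\<close>

lemma finite_psi_hull:
  assumes "finite T" "T \<subseteq> V" "b \<in> V"
  shows "finite {v \<in> V. \<forall>e. (\<forall>t\<in>T. e \<in> \<psi> t \<longleftrightarrow> e \<in> \<psi> b) \<longrightarrow> (e \<in> \<psi> v \<longleftrightarrow> e \<in> \<psi> b)}" (is "finite ?K")
proof -
  let ?U = "\<Union>t\<in>T. symdiff (\<psi> t) (\<psi> b)"
  have "finite ?U" using assms fin by (intro finite_UN_I) auto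
  moreover have "(\<lambda>v. symdiff (\<psi> v) (\<psi> b)) ` ?K \<subseteq> Pow ?U"
    unfolding symdiff_def by blast
  ultimately have "finite ((\<lambda>v. symdiff (\<psi> v) (\<psi> b)) ` ?K)" by (meson finite_Pow_iff finite_subset)
  moreover have "inj_on (\<lambda>v. symdiff (\<psi> v) (\<psi> b)) ?K"
  proof (rule inj_onI)
    fix v w assume vw: "v \<in> ?K" "w \<in> ?K" "symdiff (\<psi> v) (\<psi> b) = symdiff (\<psi> w) (\<psi> b)"
    have "e \<in> \<psi> v \<longleftrightarrow> e \<in> \<psi> w" for e
      using vw(3) symdiff_iff[of e "\<psi> v" "\<psi> b"] symdiff_iff[of e "\<psi> w" "\<psi> b"] by blast
    then have "\<psi> v = \<psi> w" by blast
    with vw show "v = w" using psi_inj by blast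
  qed
  ultimately show ?thesis by (rule finite_imageD)
qed

text \<open>The copoint of side \<open>e\<close> at \<open>b\<close> forces the antipode of \<open>p\<close> to lie between \<open>b\<close> and some
  \<open>t\<close> on the other side of \<open>e\<close>; this \<open>t\<close> must be in \<open>T\<close>, and its antipode is the gate of \<open>b\<close>.\<close>

lemma gate_edge:
  assumes ph: "\<And>A. finite A \<Longrightarrow> convex V E A \<Longrightarrow> ph_le A (induced E A) 1"
    and T: "convex V E T" "finite T" "antipodal T"
    and p: "p \<in> T" "\<forall>t\<in>T. btw a p t"
    and ab: "E a b"
  shows "\<exists>q\<in>T. \<forall>t\<in>T. btw b q t"
proof -
  have TV: "T \<subseteq> V" using T by (simp add: convex_def)
  have V: "a \<in> V" "b \<in> V" using ab edge_hdist by auto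
  obtain e where e: "\<forall>e'. (e' \<in> \<psi> a \<longleftrightarrow> e' \<in> \<psi> b) \<longleftrightarrow> e' \<noteq> e"
    using edge_coordinate[OF ab] by (rule exE)
  have pa: "\<And>e'. crosses T e' \<Longrightarrow> (e' \<in> \<psi> p \<longleftrightarrow> e' \<in> \<psi> a)" using p gate_iff by blast
  show ?thesis
  proof (cases "crosses T e")
    case False
    then have "crosses T e' \<Longrightarrow> (e' \<in> \<psi> p \<longleftrightarrow> e' \<in> \<psi> b)" for e' using pa e by metis
    then show ?thesis using gate_iff[OF p(1), of b] p(1) by blast
  next
    case True
    have pe: "e \<in> \<psi> p \<longleftrightarrow> e \<in> \<psi> a" "e \<in> \<psi> p \<longleftrightarrow> e \<notin> \<psi> b" using pa True e by blast+
    obtain p' where p': "p' \<in> T" "\<And>e. crosses T e \<Longrightarrow> (e \<in> \<psi> p') \<noteq> (e \<in> \<psi> p)"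
      using antipode[OF T(3) p(1)] by metis
    have "(e \<in> \<psi> p) \<noteq> (e \<in> \<psi> p')" "p \<in> V" "p' \<in> V" using p'(2)[OF True] TV p(1) p'(1) by auto
    \<comment> \<open>An edge of \<open>T\<close> in the class of \<open>e\<close>, with
      \<open>d\<close> on the side of \<open>b\<close>. It leads from \<open>b\<close> into
      \<open>T\<close>: \<open>d\<close> lies between \<open>b\<close> and \<open>c\<close>, and
      \<open>p'\<close> lies between \<open>d\<close> and its antipode \<open>d'\<close>. Since
      \<open>c\<close> and \<open>d'\<close> are in the half-space \<open>C\<close> below,
      \<open>p'\<close> is in the hull of \<open>C\<close> and \<open>b\<close>.\<close>
    then obtain c d where cd: "E c d" "btw p c p'" "btw p d p'"
      "e \<in> \<psi> c \<longleftrightarrow> e \<in> \<psi> p" "e \<in> \<psi> d \<longleftrightarrow> e \<in> \<psi> p'" by (metis separating_edge)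
    have cdV: "c \<in> V" "d \<in> V" using cd(1) edge_hdist by auto
    have cdT: "c \<in> T" "d \<in> T" using cd(2,3) cdV p(1) p'(1) T(1) unfolding convex_btw by blast+
    obtain d' where d': "d' \<in> T" "\<forall>s\<in>T. btw d s d'" "\<And>e. crosses T e \<Longrightarrow> (e \<in> \<psi> d') \<noteq> (e \<in> \<psi> d)"
      using antipode[OF T(3) cdT(2)] by metis
    obtain f where f: "\<forall>e'. (e' \<in> \<psi> c \<longleftrightarrow> e' \<in> \<psi> d) \<longleftrightarrow> e' \<noteq> f"
      using edge_coordinate[OF cd(1)] by (rule exE)
    have fe: "f = e" using f cd(4,5) p'(2)[OF True] by metis
    \<comment> \<open>A finite convex region around \<open>T\<close>, \<open>b\<close> and also
      \<open>a\<close>; the coordinate \<open>e\<close> puts no constraint on \<open>K\<close>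
      because \<open>p\<close> and \<open>b\<close> are separated by it.\<close>
    define K where "K = {v \<in> V. \<forall>e. (\<forall>t\<in>T. e \<in> \<psi> t \<longleftrightarrow> e \<in> \<psi> b) \<longrightarrow> (e \<in> \<psi> v \<longleftrightarrow> e \<in> \<psi> b)}"
    have KV: "K \<subseteq> V" unfolding K_def by blast
    have finK: "finite K" unfolding K_def using finite_psi_hull T(2) TV V by blast
    have convK: "convex V E K" unfolding convex_btw K_def btw_def by blast
    have TK: "T \<subseteq> K" unfolding K_def using TV by blast
    have bK: "b \<in> K" unfolding K_def using V by blast
    have aK: "a \<in> K"
    proof -
      have "\<not> (\<forall>t\<in>T. e \<in> \<psi> t \<longleftrightarrow> e \<in> \<psi> b)" using p(1) pe by blast
      then have "\<forall>e'. (\<forall>t\<in>T. e' \<in> \<psi> t \<longleftrightarrow> e' \<in> \<psi> b) \<longrightarrow> (e' \<in> \<psi> a \<longleftrightarrow> e' \<in> \<psi> b)" using e by metis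
      then show ?thesis unfolding K_def using V by blast
    qed
    interpret K: pcube K "induced E K" \<psi> using restrict_convex convK .
    define C where "C = {v \<in> K. e \<in> \<psi> v \<longleftrightarrow> e \<in> \<psi> p}"
    have convC: "convex K (induced E K) C"
      unfolding K.convex_btw C_def btw_def by blast
    have bC: "b \<notin> C" "a \<in> C" unfolding C_def using pe aK by auto
    \<comment> \<open>\<open>C\<close> is maximal because \<open>a\<close> in \<open>C\<close> is
      adjacent to \<open>b\<close>: any \<open>v\<close> on the other side of \<open>e\<close> has
      \<open>b\<close> between itself and \<open>a\<close>.\<close>
    have cop: "copoint K (induced E K) b C"
      unfolding copoint_def
    proof (intro conjI allI impI)
      fix D assume D: "convex K (induced E K) D \<and> b \<notin> D \<and> C \<subseteq> D"
      show "D = C"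
      proof (rule ccontr)
        assume "D \<noteq> C"
        with D obtain v where v: "v \<in> D" "v \<notin> C" by blast
        have "D \<subseteq> K" using D by (simp add: convex_def)
        with v have "v \<in> K" "(e \<in> \<psi> v) = (e \<in> \<psi> b)" using pe unfolding C_def by blast+
        then have "btw v b a" unfolding btw_def using e by blast
        with D v bC bK show False unfolding K.convex_btw by blast
      qed
    qed (use bK convC bC in auto)
    have "p' \<in> co K (induced E K) (C \<union> {b})"
      unfolding co_def
    proof clarify
      fix D assume D: "convex K (induced E K) D" "C \<union> {b} \<subseteq> D"
      have cC: "c \<in> C" "d' \<in> C"
        using cdT d'(1,3) TK True cd(4,5) p'(2) unfolding C_def by blast+
      have "btw b d c"
        unfolding btw_def using f fe cd(4,5) p'(2)[OF True] pe by metis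
      then have "d \<in> D" using D cC cdT TK unfolding K.convex_btw by blast
      moreover have "btw d p' d'" using d'(2) p'(1) by blast
      ultimately show "p' \<in> D" using D cC p'(1) TK unfolding K.convex_btw by blast
    qed
    \<comment> \<open>Two interval steps led to \<open>p'\<close>; the pre-hull bound compresses
      them into one. The value \<open>m = 0\<close> means that \<open>C\<close> with
      \<open>b\<close> is already its own hull.\<close>
    moreover obtain m where "m \<le> 1"
      "co K (induced E K) (C \<union> {b}) = (Iset K (induced E K) ^^ m) (C \<union> {b})"
      using ph[OF finK convK] cop unfolding ph_le_def by blast
    ultimately have "p' \<in> C \<union> {b} \<or> p' \<in> Iset K (induced E K) (C \<union> {b})"
      by (cases m) auto
    moreover have np'C: "p' \<notin> C" unfolding C_def using p'(2)[OF True] by blast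
    moreover have bK': "C \<union> {b} \<subseteq> K" using bK unfolding C_def by blast
    ultimately have "p' = b \<or> (\<exists>s\<in>C \<union> {b}. \<exists>t\<in>C \<union> {b}. btw s p' t)"
      unfolding Iset_def using K.interval_btw by blast
    moreover have "\<not> btw s p' t" if "s \<in> C" "t \<in> C" for s t
      using that convC np'C p'(1) TK unfolding K.convex_btw by blast
    moreover have "p' = b" if "btw b p' b"
      using that p'(1) TV V psi_inj[of p' b] unfolding btw_def by blast
    ultimately consider "p' = b" | t where "t \<in> C" "btw b p' t"
      using btw_commute by blast
    then show ?thesis
    proof cases
      case 1
      with p'(1) show ?thesis by (intro bexI[of _ b]) (auto simp: btw_def)
    next
      case 2
      \<comment> \<open>Uncrossed coordinates: if \<open>b\<close> agrees with \<open>T\<close>, so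
        does all of \<open>K\<close> and hence \<open>t\<close>; if not, \<open>p'\<close> between
        \<open>b\<close> and \<open>t\<close> forces \<open>t\<close> to the side of
        \<open>p'\<close>.\<close>
      have "e' \<in> \<psi> t \<longleftrightarrow> e' \<in> \<psi> p'" if "\<not> crosses T e'" for e'
      proof (cases "e' \<in> \<psi> b \<longleftrightarrow> e' \<in> \<psi> p'")
        case True
        then have "\<forall>s\<in>T. e' \<in> \<psi> s \<longleftrightarrow> e' \<in> \<psi> b" using not_crosses[OF that] p'(1) by blast
        with 2(1) True show ?thesis unfolding C_def K_def by blast
      next
        case False
        with 2(2) show ?thesis unfolding btw_def by blast
      qed
      moreover have "t \<in> V" using 2 KV unfolding C_def by blast
      ultimately have tT: "t \<in> T" using convex_agree_memI[OF T(1) p'(1)] by blast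
      obtain q where q: "q \<in> T" "\<And>e. crosses T e \<Longrightarrow> (e \<in> \<psi> q) \<noteq> (e \<in> \<psi> t)"
        using antipode[OF T(3) tT] by metis
      \<comment> \<open>On \<open>e\<close>, \<open>t\<close> is on the side of \<open>p\<close>, so
        its antipode is on that of \<open>b\<close>. On any other crossed coordinate
        \<open>b\<close> agrees with \<open>p\<close>, hence not with \<open>p'\<close>; so
        \<open>t\<close> agrees with \<open>p'\<close> and \<open>q\<close> with
        \<open>b\<close>.\<close>
      have "e' \<in> \<psi> q \<longleftrightarrow> e' \<in> \<psi> b" if cr: "crosses T e'" for e'
      proof (cases "e' = e")
        case True
        then show ?thesis using q(2)[OF cr] 2(1) pe unfolding C_def by blast
      next
        case False
        then have "e' \<in> \<psi> b \<longleftrightarrow> e' \<in> \<psi> p" using pa[OF cr] e by blast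
        with p'(2)[OF cr] 2(2) have "e' \<in> \<psi> t \<longleftrightarrow> e' \<in> \<psi> p'" unfolding btw_def by blast
        with \<open>e' \<in> \<psi> b \<longleftrightarrow> e' \<in> \<psi> p\<close> q(2)[OF cr] p'(2)[OF cr] show ?thesis by blast
      qed
      with q(1) show ?thesis using gate_iff[OF q(1), of b] by blast
    qed
  qed
qed

text \<open>A point of \<open>T\<close> is its own gate, and \<open>gate_edge\<close> carries the
  existence of gates along the edges of a geodesic leaving it.\<close>

lemma antipodal_gated:
  assumes ph: "\<And>A. finite A \<Longrightarrow> convex V E A \<Longrightarrow> ph_le A (induced E A) 1"
    and T: "convex V E T" "finite T" "antipodal T" "T \<noteq> {}"
  shows "gated T"
proof -
  obtain t0 where t0: "t0 \<in> T" using T(4) by blast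
  then have t0V: "t0 \<in> V" using T(1) by (auto simp: convex_def)
  have "\<exists>p\<in>T. \<forall>t\<in>T. btw u p t" if "u \<in> V" for u
    using that
  proof (induction "hdist u t0" arbitrary: u)
    case 0
    then have "u = t0" using hdist_eq_0 t0V by simp
    then show ?case using t0 by (intro bexI[of _ t0]) (auto simp: btw_def)
  next
    case (Suc n)
    then have ut: "u \<in> V" "t0 \<in> V" "u \<noteq> t0" using t0V by auto
    obtain v where v: "E u v" "v \<in> V" "hdist u t0 = Suc (hdist v t0)" "btw u v t0"
      by (rule geodesic_step[OF ut])
    with Suc obtain p where p: "p \<in> T" "\<forall>t\<in>T. btw v p t" by (metis Suc_inject)
    have "E v u" using v(1) gr by (simp add: graph_def)
    from gate_edge[OF ph T(1-3) p this] show ?case .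
  qed
  then show ?thesis by (simp add: gated_def)
qed

subsection \<open>The Peano axiom\<close>

text \<open>Peano's axiom of interval geometry: in a triangle \<open>u\<close>, \<open>v\<close>,
  \<open>w\<close>, with \<open>a\<close> on the side from \<open>u\<close> to \<open>w\<close> and
  \<open>b\<close> on the segment from \<open>v\<close> to \<open>a\<close>, the ray from
  \<open>u\<close> through \<open>b\<close> reaches the side from \<open>v\<close> to
  \<open>w\<close>.\<close>

definition peano_axiom :: bool where
  "peano_axiom \<longleftrightarrow> (\<forall>u\<in>V. \<forall>v\<in>V. \<forall>w\<in>V. \<forall>a\<in>V. \<forall>b\<in>V.
     btw u a w \<longrightarrow> btw v b a \<longrightarrow> (\<exists>c\<in>V. btw v c w \<and> btw u b c))"

lemma peano_axiomD:
  "peano_axiom \<Longrightarrow> u \<in> V \<Longrightarrow> v \<in> V \<Longrightarrow> w \<in> V \<Longrightarrow> a \<in> V \<Longrightarrow> b \<in> V \<Longrightarrow>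
    btw u a w \<Longrightarrow> btw v b a \<Longrightarrow> \<exists>c\<in>V. btw v c w \<and> btw u b c"
  unfolding peano_axiom_def by blast

lemma peano_axiom_convex:
  assumes "peano_axiom" "convex V E A"
  shows "pcube.peano_axiom A \<psi>"
proof -
  interpret A: pcube A "induced E A" \<psi> using restrict_convex assms(2) .
  have AV: "A \<subseteq> V" using assms(2) by (simp add: convex_def)
  show ?thesis
    unfolding A.peano_axiom_def
  proof (intro ballI impI)
    fix u v w a b assume h: "u \<in> A" "v \<in> A" "w \<in> A" "a \<in> A" "b \<in> A" "btw u a w" "btw v b a"
    then obtain c where c: "c \<in> V" "btw v c w" "btw u b c"
      using peano_axiomD[OF assms(1), of u v w a b] AV by blast
    with h assms(2) have "c \<in> A" unfolding convex_btw by blast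
    with c show "\<exists>c\<in>A. btw v c w \<and> btw u b c" by blast
  qed
qed

lemma Iset_btw:
  assumes "S \<subseteq> V"
  shows "Iset V E S = {p \<in> V. \<exists>s\<in>S. \<exists>t\<in>S. btw s p t}"
proof -
  have "Iset V E S = (\<Union>s\<in>S. \<Union>t\<in>S. {p \<in> V. btw s p t})"
    unfolding Iset_def using assms by (intro SUP_cong refl interval_btw) auto
  then show ?thesis by blast
qed

text \<open>Two applications of the Peano axiom show that the union of the segments from \<open>x\<close> to a
  convex set is already convex.\<close>

lemma peano_hull_point:
  assumes P: "peano_axiom" and C: "convex V E C" and x: "x \<in> V"
  shows "co V E (C \<union> {x}) = Iset V E (C \<union> {x})"
proof
  have CV: "C \<subseteq> V" using C by (simp add: convex_def)
  have self: "btw p p q" "btw p q q" for p q by (auto simp: btw_def)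
  have triv: "p = x" if "btw x p x" "p \<in> V" for p
    using that psi_inj[of p x] x unfolding btw_def by blast
  have ps: "Iset V E (C \<union> {x}) = {p \<in> V. \<exists>s\<in>C \<union> {x}. \<exists>t\<in>C \<union> {x}. btw s p t}"
    using CV x by (intro Iset_btw) auto
  have seg: "(\<exists>c\<in>C. btw x p c) \<or> C = {} \<and> p = x" if "p \<in> Iset V E (C \<union> {x})" for p
  proof -
    have "p \<in> V" and "\<exists>s\<in>C \<union> {x}. \<exists>t\<in>C \<union> {x}. btw s p t"
      using that unfolding ps by simp_all
    then obtain s t where st: "s \<in> C \<union> {x}" "t \<in> C \<union> {x}" "btw s p t" "p \<in> V"
      by fast
    have "s \<in> C \<or> s = x" "t \<in> C \<or> t = x" using st(1,2) by fast+
    then consider "s \<in> C" "t \<in> C" | "s = x" "t \<in> C" | "s \<in> C" "t = x" | "s = x" "t = x"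
      by fast
    then show ?thesis
    proof cases
      case 1
      then have "p \<in> C" using C st unfolding convex_btw by blast
      then show ?thesis using self by blast
    next
      case 2
      then show ?thesis using st by blast
    next
      case 3
      then show ?thesis using st btw_commute by blast
    next
      case 4
      then have "p = x" using triv st by blast
      then show ?thesis using self by blast
    qed
  qed
  have "convex V E (Iset V E (C \<union> {x}))"
    unfolding convex_btw
  proof (intro conjI ballI impI)
    show "Iset V E (C \<union> {x}) \<subseteq> V" unfolding ps by blast
    fix p q r assume h: "p \<in> Iset V E (C \<union> {x})" "q \<in> Iset V E (C \<union> {x})" "r \<in> V" "btw p r q"
    have pq: "p \<in> V" "q \<in> V" using h unfolding ps by blast+
    show "r \<in> Iset V E (C \<union> {x})"
    proof (cases "C = {}")
      case True
      then have "p = x" "q = x" using seg h by blast+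
      with h True show ?thesis using triv by blast
    next
      case False
      with seg h obtain c1 c2 where c: "c1 \<in> C" "btw x p c1" "c2 \<in> C" "btw x q c2" by blast
      \<comment> \<open>First \<open>q\<close> is pushed to \<open>c2\<close>, giving
        \<open>c\<close> between \<open>p\<close> and \<open>c2\<close> with \<open>r\<close>
        between \<open>x\<close> and \<open>c\<close>. Then \<open>p\<close> is pushed to
        \<open>c1\<close>, giving \<open>c3\<close> between \<open>c2\<close> and \<open>c1\<close>
        beyond \<open>c\<close>.\<close>
      obtain c where c': "c \<in> V" "btw p c c2" "btw x r c"
        using peano_axiomD[OF P, of x p c2 q r] c CV pq x h by blast
      have "btw c2 c p" using c' btw_commute by blast
      then obtain c3 where c3: "c3 \<in> V" "btw c2 c3 c1" "btw x c c3"
        using peano_axiomD[OF P, of x c2 c1 p c] c c' CV pq x h by blast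
      then have "c3 \<in> C" using C c unfolding convex_btw by blast
      moreover have "btw x r c3" using c' c3 unfolding btw_def by blast
      ultimately show ?thesis using h unfolding ps by blast
    qed
  qed
  moreover have "C \<union> {x} \<subseteq> Iset V E (C \<union> {x})" unfolding ps using self CV x by blast
  ultimately show "co V E (C \<union> {x}) \<subseteq> Iset V E (C \<union> {x})" unfolding co_def by blast
  show "Iset V E (C \<union> {x}) \<subseteq> co V E (C \<union> {x})"
    unfolding co_def ps convex_btw by blast
qed

lemma peano_ph_le:
  assumes "peano_axiom" "convex V E A"
  shows "ph_le A (induced E A) 1"
proof -
  interpret A: pcube A "induced E A" \<psi> using restrict_convex assms(2) .
  have "A.peano_axiom" using peano_axiom_convex assms .
  then show ?thesis
    unfolding ph_le_def copoint_def using A.peano_hull_point by (intro exI[of _ 1]) auto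
qed

text \<open>The coordinatewise content of the quasi-median equations, which is all that the Peano
  axiom requires of them.\<close>

definition quasi_btw :: "'a \<Rightarrow> 'a \<Rightarrow> 'a \<Rightarrow> 'a \<Rightarrow> 'a \<Rightarrow> 'a \<Rightarrow> bool" where
  "quasi_btw u v w x y z \<longleftrightarrow> btw u x v \<and> btw u y v \<and> btw v y w \<and> btw v z w \<and> btw w z u \<and> btw w x u"

text \<open>The point \<open>c\<close> is the median of \<open>(b, v, w)\<close>, or else the antipode, in the gated set \<open>T\<close>, of
  the gate of \<open>u\<close>.\<close>

lemma peano_axiomI:
  assumes "\<And>u v w. u \<in> V \<Longrightarrow> v \<in> V \<Longrightarrow> w \<in> V \<Longrightarrow>
      (\<exists>m\<in>V. btw u m v \<and> btw v m w \<and> btw w m u) \<or>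
      (\<exists>x y z T. T \<subseteq> V \<and> antipodal T \<and> gated T \<and> x \<in> T \<and> y \<in> T \<and> z \<in> T \<and> quasi_btw u v w x y z \<and>
        (\<forall>e. crosses T e \<longrightarrow> \<not> ((e \<in> \<psi> x \<longleftrightarrow> e \<in> \<psi> y) \<and> (e \<in> \<psi> x \<longleftrightarrow> e \<in> \<psi> z))))"
  shows peano_axiom
  unfolding peano_axiom_def
proof (intro ballI impI)
  fix u v w a b assume h: "u \<in> V" "v \<in> V" "w \<in> V" "a \<in> V" "b \<in> V" "btw u a w" "btw v b a"
  have b: "e \<in> \<psi> b \<longleftrightarrow> e \<in> \<psi> u"
    if "e \<in> \<psi> v \<longleftrightarrow> e \<in> \<psi> u" "e \<in> \<psi> w \<longleftrightarrow> e \<in> \<psi> u" for e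
    using that h(6,7) unfolding btw_def by blast
  from assms[OF h(5,2,3)] show "\<exists>c\<in>V. btw v c w \<and> btw u b c"
  proof (elim disjE exE bexE conjE)
    fix m assume m: "m \<in> V" "btw b m v" "btw v m w" "btw w m b"
    have "btw u b m" unfolding btw_def
    proof (intro allI impI)
      fix e assume "e \<in> \<psi> u \<longleftrightarrow> e \<in> \<psi> m"
      with m(2,4) b[of e] show "e \<in> \<psi> b \<longleftrightarrow> e \<in> \<psi> u" unfolding btw_def by blast
    qed
    with m show ?thesis by blast
  next
    fix x y z T
    assume T: "T \<subseteq> V" "antipodal T" "gated T" and xyz: "x \<in> T" "y \<in> T" "z \<in> T"
      and q: "quasi_btw b v w x y z"
      and cr: "\<forall>e. crosses T e \<longrightarrow> \<not> ((e \<in> \<psi> x \<longleftrightarrow> e \<in> \<psi> y) \<and> (e \<in> \<psi> x \<longleftrightarrow> e \<in> \<psi> z))"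
    obtain p where p: "p \<in> T" "\<forall>t\<in>T. btw u p t" using T(3) h(1) unfolding gated_def by blast
    then have pu: "\<And>e. crosses T e \<Longrightarrow> (e \<in> \<psi> p \<longleftrightarrow> e \<in> \<psi> u)" using gate_iff by blast
    obtain c where c: "c \<in> T" "\<And>e. crosses T e \<Longrightarrow> (e \<in> \<psi> c) \<noteq> (e \<in> \<psi> p)"
      using antipode[OF T(2) p(1)] by blast
    have bx: "e \<in> \<psi> x \<longleftrightarrow> e \<in> \<psi> b" if "(e \<in> \<psi> b \<longleftrightarrow> e \<in> \<psi> v) \<or> (e \<in> \<psi> b \<longleftrightarrow> e \<in> \<psi> w)" for e
    proof -
      have "btw b x v" "btw w x b" using q by (auto simp: quasi_btw_def)
      with that show ?thesis unfolding btw_def by blast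
    qed
    have yz: "e \<in> \<psi> y \<longleftrightarrow> e \<in> \<psi> v" "e \<in> \<psi> z \<longleftrightarrow> e \<in> \<psi> v"
      if "e \<in> \<psi> v \<longleftrightarrow> e \<in> \<psi> w" for e
      using q that unfolding quasi_btw_def btw_def by blast+
    \<comment> \<open>On a crossed \<open>e\<close> where \<open>v\<close> and \<open>w\<close>
      agree, \<open>y\<close> and \<open>z\<close> join them, so \<open>x\<close> is opposite, hence
      so are \<open>b\<close> and then \<open>u\<close>. The gate \<open>p\<close> copies
      \<open>u\<close>, and its antipode \<open>c\<close> returns to the side of
      \<open>v\<close>.\<close>
    have "(e \<in> \<psi> c \<longleftrightarrow> e \<in> \<psi> v)" if e: "e \<in> \<psi> v \<longleftrightarrow> e \<in> \<psi> w" for e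
    proof (cases "crosses T e")
      case True
      have "(e \<in> \<psi> x) \<noteq> (e \<in> \<psi> v)" using cr True yz[OF e] by blast
      then have "(e \<in> \<psi> b) \<noteq> (e \<in> \<psi> v)" using bx[of e] by blast
      then have "(e \<in> \<psi> u) \<noteq> (e \<in> \<psi> v)" using b[of e] e by blast
      then show ?thesis using c(2)[OF True] pu[OF True] by blast
    next
      case False
      then show ?thesis
        using not_crosses[OF False c(1) xyz(2)] yz(1)[OF e] by blast
    qed
    \<comment> \<open>Crossed coordinates separate \<open>u\<close> from \<open>c\<close>. On an
      uncrossed one \<open>c\<close> agrees with \<open>x\<close>; if \<open>b\<close> differed from
      \<open>u\<close>, then \<open>v\<close> or \<open>w\<close> would agree with \<open>b\<close>,
      forcing \<open>x\<close> onto the side of \<open>b\<close>.\<close>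
    moreover have "(e \<in> \<psi> b \<longleftrightarrow> e \<in> \<psi> u)" if e: "e \<in> \<psi> u \<longleftrightarrow> e \<in> \<psi> c" for e
    proof (cases "crosses T e")
      case True
      then show ?thesis using c(2)[OF True] pu[OF True] e by blast
    next
      case False
      then show ?thesis
        using not_crosses[OF False c(1) xyz(1)] e b[of e] bx[of e] by blast
    qed
    ultimately have "btw v c w \<and> btw u b c" unfolding btw_def by blast
    then show ?thesis using c T by blast
  qed
qed

end

section \<open>Nonexpansive maps of a torus\<close>

definition cycle_dist :: "nat \<Rightarrow> nat \<Rightarrow> nat \<Rightarrow> nat" where
  "cycle_dist N a b = min ((a - b) + (b - a)) (N - ((a - b) + (b - a)))"

text \<open>Removes \<open>min\<close> and truncated subtraction: the distance is at most half the
  cycle and is realised in one of the two directions, with or without wrapping. Linear arithmetic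
  does the rest.\<close>

lemma cycle_dist_char:
  assumes "a < N" "b < N"
  shows "2 * cycle_dist N a b \<le> N \<and>
    (a + cycle_dist N a b = b \<or> b + cycle_dist N a b = a \<or> a + N = b + cycle_dist N a b \<or> b + N = a + cycle_dist N a b)"
proof (cases "a \<le> b")
  case True
  with assms show ?thesis by (cases "2 * (b - a) \<le> N") (auto simp: cycle_dist_def min_def)
next
  case False
  with assms show ?thesis by (cases "2 * (a - b) \<le> N") (auto simp: cycle_dist_def min_def)
qed

lemma cycle_dist_commute: "cycle_dist N a b = cycle_dist N b a"
  by (simp add: cycle_dist_def add.commute)

lemma cycle_dist_self [simp]: "cycle_dist N a a = 0"
  by (simp add: cycle_dist_def)

lemma cycle_dist_eq_0: assumes "a < N" "b < N" shows "cycle_dist N a b = 0 \<longleftrightarrow> a = b"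
  using cycle_dist_char[OF assms] assms by auto

lemma cycle_dist_triangle:
  assumes "a < N" "b < N" "c < N" shows "cycle_dist N a b \<le> cycle_dist N a c + cycle_dist N c b"
  using cycle_dist_char[OF assms(1,2)] cycle_dist_char[OF assms(1,3)] cycle_dist_char[OF assms(3,2)] assms by linarith

text \<open>Three points cut the cycle into three arcs. If none exceeds half of it, the arcs are
  geodesics and add up to \<open>N\<close>; otherwise the geodesic replacing the long arc passes
  through the third point.\<close>

lemma cycle_dist_median_or_perimeter:
  assumes "a < N" "b < N" "c < N"
  shows "cycle_dist N a b + cycle_dist N b c + cycle_dist N c a = N \<or> cycle_dist N a b = cycle_dist N b c + cycle_dist N c a \<or>
    cycle_dist N b c = cycle_dist N a b + cycle_dist N c a \<or> cycle_dist N c a = cycle_dist N a b + cycle_dist N b c"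
  using cycle_dist_char[OF assms(1,2)] cycle_dist_char[OF assms(2,3)] cycle_dist_char[OF assms(3,1)] assms by linarith

text \<open>Going \<open>d\<close> steps in the positive direction from \<open>x\<close> reaches
  \<open>y\<close>, for positions below \<open>N\<close> and \<open>d \<le> N\<close>. Written
  without \<open>mod\<close> for linear arithmetic.\<close>

definition ahead :: "nat \<Rightarrow> nat \<Rightarrow> nat \<Rightarrow> nat \<Rightarrow> bool" where
  "ahead N x d y \<longleftrightarrow> x + d = y \<or> x + d = y + N"

lemma ahead_cases:
  assumes "x < N" "y < N" shows "ahead N x (cycle_dist N x y) y \<or> ahead N y (cycle_dist N x y) x"
  using cycle_dist_char[OF assms] by (auto simp: ahead_def)

text \<open>A triangle winding around the cycle has an orientation. The strict bounds exclude
  antipodal corners, for which both directions are geodesic.\<close>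

lemma ahead_triangle:
  assumes "x < N" "y < N" "z < N"
    and "cycle_dist N x y + cycle_dist N y z + cycle_dist N z x = N" "2 * cycle_dist N x y < N" "2 * cycle_dist N y z < N" "2 * cycle_dist N z x < N"
    and "ahead N x (cycle_dist N x y) y"
  shows "ahead N z (cycle_dist N z x) x"
  using cycle_dist_char[OF assms(1,2)] cycle_dist_char[OF assms(2,3)] cycle_dist_char[OF assms(3,1)] assms
  unfolding ahead_def by linarith

lemma ahead_between:
  assumes "x < N" "y < N" "a < N" "cycle_dist N x a + cycle_dist N a y = cycle_dist N x y" "2 * cycle_dist N x y < N"
    and "ahead N x (cycle_dist N x y) y"
  shows "ahead N x (cycle_dist N x a) a"
  using cycle_dist_char[OF assms(1,2)] cycle_dist_char[OF assms(1,3)] cycle_dist_char[OF assms(3,2)] assms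
  unfolding ahead_def by linarith

lemma ahead_between':
  assumes "x < N" "y < N" "a < N" "cycle_dist N x a + cycle_dist N a y = cycle_dist N x y" "2 * cycle_dist N x y < N"
    and "ahead N y (cycle_dist N x y) x"
  shows "ahead N a (cycle_dist N x a) x"
proof -
  have "ahead N y (cycle_dist N y a) a"
    using ahead_between[of y N x a] assms cycle_dist_commute by (metis add.commute)
  then show ?thesis using assms cycle_dist_commute[of N y a] unfolding ahead_def by linarith
qed

lemma ahead_cycle_dist:
  assumes "x < N" "a < N" "b < N" "ahead N x p a" "ahead N b q x" "p + q \<le> N"
  shows "cycle_dist N a b = min (p + q) (N - (p + q))"
  using cycle_dist_char[OF assms(2,3)] assms unfolding ahead_def by linarith

lemma cycle_dist_ahead: "x < N \<Longrightarrow> y < N \<Longrightarrow> ahead N x d y \<Longrightarrow> 2 * d \<le> N \<Longrightarrow> cycle_dist N x y = d"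
  using ahead_cycle_dist[of x N y x d 0] cycle_dist_commute[of N x y] by (simp add: ahead_def)

text \<open>The arcs to \<open>y\<close> and to \<open>z\<close> leave \<open>x\<close> in opposite
  directions, so going from \<open>a\<close> to \<open>b\<close> through \<open>x\<close> never
  backtracks; the only competitor is the way around.\<close>

lemma cycle_dist_opposite:
  assumes "x < N" "y < N" "z < N" "a < N" "b < N"
    and p: "cycle_dist N x y + cycle_dist N y z + cycle_dist N z x = N" "2 * cycle_dist N x y < N" "2 * cycle_dist N y z < N" "2 * cycle_dist N z x < N"
    and a: "cycle_dist N x a + cycle_dist N a y = cycle_dist N x y" and b: "cycle_dist N x b + cycle_dist N b z = cycle_dist N x z"
  shows "cycle_dist N a b = min (cycle_dist N x a + cycle_dist N x b) (N - (cycle_dist N x a + cycle_dist N x b))"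
proof -
  have xz: "cycle_dist N x z = cycle_dist N z x" by (rule cycle_dist_commute)
  have le: "cycle_dist N x a + cycle_dist N x b \<le> N" using assms xz by linarith
  from ahead_cases[OF assms(1,2)] show ?thesis
  proof
    assume o: "ahead N x (cycle_dist N x y) y"
    have "ahead N x (cycle_dist N x a) a" using ahead_between assms o by blast
    moreover have "ahead N z (cycle_dist N x z) x" using ahead_triangle assms o xz by metis
    then have "ahead N b (cycle_dist N x b) x" using ahead_between' assms xz by metis
    ultimately show ?thesis using ahead_cycle_dist assms le by blast
  next
    assume o: "ahead N y (cycle_dist N x y) x"
    have "ahead N a (cycle_dist N x a) x" using ahead_between' assms o by blast
    moreover have "ahead N x (cycle_dist N x z) z"
      using o cycle_dist_char[OF assms(2,3)] cycle_dist_char[OF assms(3,1)] assms xz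
      unfolding ahead_def by linarith
    then have "ahead N x (cycle_dist N x b) b" using ahead_between[OF assms(1,3,5) b] p xz by simp
    ultimately have "cycle_dist N b a = min (cycle_dist N x b + cycle_dist N x a) (N - (cycle_dist N x b + cycle_dist N x a))"
      using ahead_cycle_dist assms le by (metis add.commute)
    then show ?thesis by (simp add: cycle_dist_commute add.commute)
  qed
qed

lemma cycle_dist_unique:
  assumes "x < N" "y < N" "a < N" "b < N" "2 * cycle_dist N x y < N"
    and "cycle_dist N x a + cycle_dist N a y = cycle_dist N x y" "cycle_dist N x b + cycle_dist N b y = cycle_dist N x y" "cycle_dist N x a = cycle_dist N x b"
  shows "a = b"
  using ahead_cases[OF assms(1,2)]
proof
  assume "ahead N x (cycle_dist N x y) y"
  then have "ahead N x (cycle_dist N x a) a" "ahead N x (cycle_dist N x b) b" using ahead_between assms by blast+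
  with assms show ?thesis unfolding ahead_def by linarith
next
  assume "ahead N y (cycle_dist N x y) x"
  then have "ahead N a (cycle_dist N x a) x" "ahead N b (cycle_dist N x b) x" using ahead_between' assms by blast+
  with assms show ?thesis unfolding ahead_def by linarith
qed

lemma cycle_dist_cover_oriented:
  assumes "x < N" "y < N" "z < N" "t < N"
    and "cycle_dist N x y + cycle_dist N y z + cycle_dist N z x = N" "2 * cycle_dist N x y < N" "2 * cycle_dist N y z < N" "2 * cycle_dist N z x < N"
    and o: "ahead N x (cycle_dist N x y) y"
  shows "cycle_dist N x t + cycle_dist N t y = cycle_dist N x y \<or> cycle_dist N y t + cycle_dist N t z = cycle_dist N y z \<or> cycle_dist N z t + cycle_dist N t x = cycle_dist N z x"
proof -
  have zx: "ahead N z (cycle_dist N z x) x" using ahead_triangle assms by blast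
  have yz: "ahead N y (cycle_dist N y z) z" using o zx assms unfolding ahead_def by linarith
  \<comment> \<open>The number of positive steps from \<open>x\<close> to \<open>t\<close>;
    comparing it with the lengths of the arcs tells which arc contains \<open>t\<close>.\<close>
  define k where "k = (if x \<le> t then t - x else t + N - x)"
  have k: "ahead N x k t" "k < N" using assms by (auto simp: k_def ahead_def)
  consider "k \<le> cycle_dist N x y" | "cycle_dist N x y \<le> k" "k \<le> cycle_dist N x y + cycle_dist N y z" | "cycle_dist N x y + cycle_dist N y z \<le> k"
    by linarith
  then show ?thesis
  proof cases
    case 1
    then have "ahead N t (cycle_dist N x y - k) y" using k o assms unfolding ahead_def by linarith
    then have "cycle_dist N t y = cycle_dist N x y - k" by (rule cycle_dist_ahead[OF assms(4,2)]) (use assms in linarith)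
    moreover have "cycle_dist N x t = k" by (rule cycle_dist_ahead[OF assms(1,4) k(1)]) (use 1 assms in linarith)
    ultimately show ?thesis using 1 by simp
  next
    case 2
    then have "ahead N y (k - cycle_dist N x y) t" using k o assms unfolding ahead_def by linarith
    then have "cycle_dist N y t = k - cycle_dist N x y" by (rule cycle_dist_ahead[OF assms(2,4)]) (use 2 assms in linarith)
    moreover have "ahead N t (cycle_dist N x y + cycle_dist N y z - k) z"
      using 2 k o yz assms unfolding ahead_def by linarith
    then have "cycle_dist N t z = cycle_dist N x y + cycle_dist N y z - k" by (rule cycle_dist_ahead[OF assms(4,3)]) (use 2 assms in linarith)
    ultimately show ?thesis using 2 by simp
  next
    case 3
    then have "ahead N z (k - (cycle_dist N x y + cycle_dist N y z)) t"
      using k o yz assms unfolding ahead_def by linarith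
    then have "cycle_dist N z t = k - (cycle_dist N x y + cycle_dist N y z)" by (rule cycle_dist_ahead[OF assms(3,4)]) (use 3 k assms in linarith)
    moreover have "ahead N t (N - k) x" using 3 k assms unfolding ahead_def by linarith
    then have "cycle_dist N t x = N - k" by (rule cycle_dist_ahead[OF assms(4,1)]) (use 3 assms in linarith)
    ultimately show ?thesis using 3 k assms by linarith
  qed
qed

lemma cycle_dist_cover:
  assumes "x < N" "y < N" "z < N" "t < N"
    and p: "cycle_dist N x y + cycle_dist N y z + cycle_dist N z x = N" "2 * cycle_dist N x y < N" "2 * cycle_dist N y z < N" "2 * cycle_dist N z x < N"
  shows "cycle_dist N x t + cycle_dist N t y = cycle_dist N x y \<or> cycle_dist N y t + cycle_dist N t z = cycle_dist N y z \<or> cycle_dist N z t + cycle_dist N t x = cycle_dist N z x"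
  using ahead_cases[OF assms(1,2)]
proof
  assume "ahead N x (cycle_dist N x y) y"
  with cycle_dist_cover_oriented assms show ?thesis by blast
next
  assume "ahead N y (cycle_dist N x y) x"
  then have "ahead N y (cycle_dist N y x) x" using cycle_dist_commute by metis
  with cycle_dist_cover_oriented[of y N x z t] assms have
    "cycle_dist N y t + cycle_dist N t x = cycle_dist N y x \<or> cycle_dist N x t + cycle_dist N t z = cycle_dist N x z \<or> cycle_dist N z t + cycle_dist N t y = cycle_dist N z y"
    by (simp add: cycle_dist_commute add.commute add.left_commute)
  then show ?thesis by (auto simp: cycle_dist_commute add.commute)
qed

lemma cycle_dist_Suc_mod:
  assumes "a < N" "N \<ge> 2"
  shows "cycle_dist N a (Suc a mod N) = 1"
proof -
  have l: "Suc a mod N < N" using assms by simp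
  have "Suc a = Suc a mod N \<or> Suc a = Suc a mod N + N" using assms by (cases "Suc a = N") auto
  then show ?thesis using cycle_dist_char[OF assms(1) l] assms by linarith
qed

lemma cycle_dist_step:
  assumes "a < N" "b < N" "a \<noteq> b"
  shows "\<exists>c<N. (c = Suc a mod N \<or> a = Suc c mod N) \<and> cycle_dist N a b = Suc (cycle_dist N c b)"
proof -
  have N: "N \<ge> 2" using assms by linarith
  define s where "s = Suc a mod N"
  define r where "r = (if a = 0 then N - 1 else a - 1)"
  have l: "s < N" "r < N" using assms by (auto simp: s_def r_def)
  have "Suc a = s \<or> Suc a = s + N" using assms unfolding s_def by (cases "Suc a = N") auto
  then have as: "ahead N a 1 s" by (simp add: ahead_def)
  have "Suc r = a \<or> Suc r = a + N" using assms unfolding r_def by auto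
  then have ra: "ahead N r 1 a" by (simp add: ahead_def)
  have m: "Suc r mod N = a" using assms N unfolding r_def by auto
  have d: "cycle_dist N a b > 0" "2 * cycle_dist N a b \<le> N" using cycle_dist_eq_0 cycle_dist_char assms by auto
  from ahead_cases[OF assms(1,2)] show ?thesis
  proof
    assume "ahead N a (cycle_dist N a b) b"
    then have "ahead N s (cycle_dist N a b - 1) b" using as d l assms unfolding ahead_def by linarith
    then have "cycle_dist N s b = cycle_dist N a b - 1" by (rule cycle_dist_ahead[OF l(1) assms(2)]) (use d in linarith)
    then show ?thesis using d l(1) s_def by (intro exI[of _ s]) simp
  next
    assume "ahead N b (cycle_dist N a b) a"
    then have "ahead N b (cycle_dist N a b - 1) r" using ra d l assms unfolding ahead_def by linarith
    then have "cycle_dist N b r = cycle_dist N a b - 1" by (rule cycle_dist_ahead[OF assms(2) l(2)]) (use d in linarith)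
    then show ?thesis using d l(2) m cycle_dist_commute[of N b r] by (intro exI[of _ r]) simp
  qed
qed

lemma cycle_dist_antipode_between:
  assumes "p < N" "c < N" "a < N" "2 * cycle_dist N p c = N"
  shows "cycle_dist N p a + cycle_dist N a c = cycle_dist N p c"
  using cycle_dist_char[OF assms(1,2)] cycle_dist_char[OF assms(1,3)] cycle_dist_char[OF assms(3,2)] assms by linarith

lemma cycle_dist_antipode:
  assumes "even N" "a < N"
  shows "\<exists>a'<N. 2 * cycle_dist N a a' = N"
proof -
  define n where "n = N div 2"
  have n: "N = 2 * n" using assms by (simp add: n_def)
  define a' where "a' = (if a < n then a + n else a - n)"
  have a': "a' < N" using assms n by (auto simp: a'_def)
  have "ahead N a n a'" using n by (auto simp: ahead_def a'_def)
  then have "cycle_dist N a a' = n" using cycle_dist_ahead[OF assms(2) a'] n by simp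
  with a' n show ?thesis by auto
qed

text \<open>An obstruction to a nonexpansive map that moves points by at most one, and only towards
  \<open>p\<close>, yet sends the antipode \<open>c\<close> of \<open>p\<close> to a neighbour
  \<open>w\<close>. The other neighbour \<open>t\<close> of \<open>c\<close> either stays, at
  distance 2 from \<open>w\<close>, or moves to a point at distance 3. In a 4-cycle the latter would
  be adjacent to \<open>w\<close>.\<close>

lemma cycle_dist_two_neighbours:
  assumes "N \<ge> 6" "p < N" "c < N" "w < N" "2 * cycle_dist N p c = N" "cycle_dist N c w = 1"
  shows "\<exists>t<N. cycle_dist N t c = 1 \<and> cycle_dist N t w = 2 \<and>
    (\<forall>v<N. cycle_dist N t v = 1 \<longrightarrow> cycle_dist N v p < cycle_dist N t p \<longrightarrow> cycle_dist N v w \<ge> 2)"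
proof -
  obtain t where t: "t < N" "t \<noteq> w" "ahead N c 1 t \<and> ahead N w 1 c \<or> ahead N t 1 c \<and> ahead N c 1 w"
  proof (cases "ahead N w 1 c")
    case True
    let ?t = "if Suc c = N then 0 else Suc c"
    have "ahead N c 1 ?t" "?t < N" using assms by (auto simp: ahead_def)
    moreover from this have "?t \<noteq> w" using True assms(1) unfolding ahead_def by linarith
    ultimately show ?thesis using that True by blast
  next
    case False
    then have w: "ahead N c 1 w" using ahead_cases[OF assms(3,4)] assms(6) by auto
    let ?t = "if c = 0 then N - 1 else c - 1"
    have "ahead N ?t 1 c" "?t < N" using assms by (auto simp: ahead_def)
    moreover from this have "?t \<noteq> w" using w assms(1) unfolding ahead_def by linarith
    ultimately show ?thesis using that w by blast
  qed
  have tc: "cycle_dist N t c = 1"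
    using t cycle_dist_ahead[of t N c 1] cycle_dist_ahead[of c N t 1] cycle_dist_commute[of N c t] assms by auto
  have "ahead N w 2 t \<or> ahead N t 2 w" using t(3) t(1) assms unfolding ahead_def by linarith
  then have tw: "cycle_dist N t w = 2"
    using cycle_dist_ahead[OF t(1) assms(4), of 2] cycle_dist_ahead[OF assms(4) t(1), of 2] assms(1) cycle_dist_commute[of N t w]
    by auto
  have tp: "cycle_dist N t p + 1 = cycle_dist N c p"
    using cycle_dist_antipode_between[OF assms(2,3) t(1) assms(5)] tc cycle_dist_commute by metis
  have "cycle_dist N v w \<ge> 2" if v: "v < N" "cycle_dist N t v = 1" "cycle_dist N v p < cycle_dist N t p" for v
  proof -
    have "v \<noteq> c" using v tp by auto
    then have "ahead N c 2 v \<and> ahead N w 1 c \<or> ahead N v 2 c \<and> ahead N c 1 w"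
      using t(1,3) v(1,2) ahead_cases[OF t(1) v(1)] assms(1,3,4) unfolding ahead_def by linarith
    then have "ahead N w 3 v \<or> ahead N v 3 w" using v(1) assms(1,3,4) unfolding ahead_def by linarith
    then have "cycle_dist N v w = 3"
      using cycle_dist_ahead[OF v(1) assms(4), of 3] cycle_dist_ahead[OF assms(4) v(1), of 3] assms(1) cycle_dist_commute[of N v w]
      by auto
    then show ?thesis by simp
  qed
  with t(1) tc tw show ?thesis by blast
qed

section \<open>Products of cycles\<close>

definition torus_dist :: "nat list \<Rightarrow> nat list \<Rightarrow> nat list \<Rightarrow> nat" where
  "torus_dist ns p q = (\<Sum>i<length ns. cycle_dist (ns ! i) (p ! i) (q ! i))"

definition off_dist :: "nat list \<Rightarrow> nat \<Rightarrow> nat list \<Rightarrow> nat list \<Rightarrow> nat" where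
  "off_dist ns i p q = (\<Sum>j\<in>{..<length ns} - {i}. cycle_dist (ns ! j) (p ! j) (q ! j))"

lemma torus_length: "p \<in> torus_verts ns \<Longrightarrow> length p = length ns"
  by (simp add: torus_verts_def)

lemma torus_nth: "p \<in> torus_verts ns \<Longrightarrow> i < length ns \<Longrightarrow> p ! i < ns ! i"
  by (simp add: torus_verts_def)

lemma torus_update: "p \<in> torus_verts ns \<Longrightarrow> t < ns ! i \<Longrightarrow> p[i := t] \<in> torus_verts ns"
  by (cases "i < length p") (auto simp: torus_verts_def nth_list_update list_update_beyond)

lemma torus_eqI:
  "p \<in> torus_verts ns \<Longrightarrow> q \<in> torus_verts ns \<Longrightarrow> (\<And>i. i < length ns \<Longrightarrow> p ! i = q ! i) \<Longrightarrow> p = q"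
  by (auto simp: torus_verts_def intro: nth_equalityI)

lemma torus_dist_split: "i < length ns \<Longrightarrow> torus_dist ns p q = cycle_dist (ns ! i) (p ! i) (q ! i) + off_dist ns i p q"
  unfolding torus_dist_def off_dist_def by (rule sum.remove) auto

lemma off_dist_update [simp]:
  "off_dist ns i (p[i := t]) q = off_dist ns i p q" "off_dist ns i p (q[i := t]) = off_dist ns i p q"
  unfolding off_dist_def by (auto intro: sum.cong)

lemma off_dist_self [simp]: "off_dist ns i p p = 0"
  by (simp add: off_dist_def)

lemma torus_dist_self [simp]: "torus_dist ns p p = 0"
  by (simp add: torus_dist_def)

lemma torus_dist_commute: "torus_dist ns p q = torus_dist ns q p"
  by (simp add: torus_dist_def cycle_dist_commute)

lemma off_dist_commute: "off_dist ns i p q = off_dist ns i q p"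
  by (simp add: off_dist_def cycle_dist_commute)

lemma torus_dist_triangle:
  assumes "p \<in> torus_verts ns" "q \<in> torus_verts ns" "r \<in> torus_verts ns"
  shows "torus_dist ns p q \<le> torus_dist ns p r + torus_dist ns r q"
  unfolding torus_dist_def sum.distrib[symmetric]
  by (intro sum_mono cycle_dist_triangle) (use assms torus_nth in auto)

lemma off_dist_triangle:
  assumes "p \<in> torus_verts ns" "q \<in> torus_verts ns" "r \<in> torus_verts ns"
  shows "off_dist ns i p q \<le> off_dist ns i p r + off_dist ns i r q"
  unfolding off_dist_def sum.distrib[symmetric]
  by (intro sum_mono cycle_dist_triangle) (use assms torus_nth in auto)

lemma torus_dist_eq_0:
  assumes "p \<in> torus_verts ns" "q \<in> torus_verts ns"
  shows "torus_dist ns p q = 0 \<longleftrightarrow> p = q"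
proof
  assume "torus_dist ns p q = 0"
  then have "cycle_dist (ns ! i) (p ! i) (q ! i) = 0" if "i < length ns" for i
    using that by (simp add: torus_dist_def)
  then show "p = q" using assms by (intro torus_eqI[of p ns q]) (auto simp: cycle_dist_eq_0 torus_nth)
qed simp

lemma off_dist_eq_0:
  assumes "p \<in> torus_verts ns" "q \<in> torus_verts ns" "off_dist ns i p q = 0" "j < length ns" "j \<noteq> i"
  shows "p ! j = q ! j"
proof -
  have "cycle_dist (ns ! j) (p ! j) (q ! j) = 0" using assms by (simp add: off_dist_def)
  then show ?thesis using assms by (simp add: cycle_dist_eq_0 torus_nth)
qed

text \<open>A sum of triangle inequalities is tight only if each one is.\<close>

lemma torus_dist_between:
  assumes "p \<in> torus_verts ns" "q \<in> torus_verts ns" "r \<in> torus_verts ns"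
  shows "torus_dist ns p r + torus_dist ns r q = torus_dist ns p q \<longleftrightarrow>
    (\<forall>i<length ns. cycle_dist (ns ! i) (p ! i) (r ! i) + cycle_dist (ns ! i) (r ! i) (q ! i) = cycle_dist (ns ! i) (p ! i) (q ! i))"
    (is "?L \<longleftrightarrow> ?R")
proof
  assume L: ?L
  show ?R
  proof (intro allI impI)
    fix i assume i: "i < length ns"
    have "cycle_dist (ns ! i) (p ! i) (q ! i) = cycle_dist (ns ! i) (p ! i) (r ! i) + cycle_dist (ns ! i) (r ! i) (q ! i)"
      by (rule sum_mono_inv[of "\<lambda>i. cycle_dist (ns ! i) (p ! i) (q ! i)" "{..<length ns}"])
        (use L assms torus_nth i in \<open>auto simp: torus_dist_def sum.distrib intro!: cycle_dist_triangle\<close>)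
    then show "cycle_dist (ns ! i) (p ! i) (r ! i) + cycle_dist (ns ! i) (r ! i) (q ! i) = cycle_dist (ns ! i) (p ! i) (q ! i)"
      by simp
  qed
next
  assume ?R
  then show ?L by (simp add: torus_dist_def sum.distrib[symmetric])
qed

lemma torus_dist_update:
  assumes "p \<in> torus_verts ns" "i < length ns"
  shows "torus_dist ns p (p[i := t]) = cycle_dist (ns ! i) (p ! i) t"
  using assms by (simp add: torus_dist_split torus_length)

lemma torus_adj_torus_dist:
  assumes "p \<in> torus_verts ns" "q \<in> torus_verts ns" "torus_adj ns p q" "\<forall>n\<in>set ns. n \<ge> 2"
  shows "torus_dist ns p q = 1"
proof -
  obtain i where i: "i < length ns" "\<And>j. j < length ns \<Longrightarrow> j \<noteq> i \<Longrightarrow> p ! j = q ! j"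
    "q ! i = Suc (p ! i) mod (ns ! i) \<or> p ! i = Suc (q ! i) mod (ns ! i)"
    using assms(3) unfolding torus_adj_def by blast
  have "off_dist ns i p q = 0" unfolding off_dist_def using i(2) by simp
  moreover have "ns ! i \<ge> 2" using assms(4) i(1) by simp
  then have "cycle_dist (ns ! i) (p ! i) (q ! i) = 1"
    using i(1,3) assms(1,2) cycle_dist_Suc_mod torus_nth cycle_dist_commute by metis
  ultimately show ?thesis using torus_dist_split[OF i(1)] by simp
qed

lemma torus_step:
  assumes "p \<in> torus_verts ns" "q \<in> torus_verts ns" "p \<noteq> q"
  shows "\<exists>r\<in>torus_verts ns. torus_adj ns p r \<and> torus_dist ns p q = Suc (torus_dist ns r q)"
proof -
  obtain i where i: "i < length ns" "p ! i \<noteq> q ! i" using torus_eqI assms by blast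
  obtain c where c: "c < ns ! i" "c = Suc (p ! i) mod (ns ! i) \<or> p ! i = Suc c mod (ns ! i)"
    "cycle_dist (ns ! i) (p ! i) (q ! i) = Suc (cycle_dist (ns ! i) c (q ! i))"
    using cycle_dist_step[OF torus_nth[OF assms(1) i(1)] torus_nth[OF assms(2) i(1)] i(2)] by blast
  have "torus_adj ns p (p[i := c])"
    unfolding torus_adj_def using i c assms(1) torus_length by (intro exI[of _ i]) auto
  moreover have "torus_dist ns p q = Suc (torus_dist ns (p[i := c]) q)"
    using torus_dist_split[OF i(1), of p q] torus_dist_split[OF i(1), of "p[i := c]" q] c(3) i(1) assms(1) torus_length
    by simp
  ultimately show ?thesis using torus_update[OF assms(1) c(1)] by blast
qed

lemma torus_antipode:
  assumes "p \<in> torus_verts ns" "\<forall>n\<in>set ns. even n"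
  shows "\<exists>p'\<in>torus_verts ns. \<forall>q\<in>torus_verts ns. torus_dist ns p q + torus_dist ns q p' = torus_dist ns p p'"
proof -
  have "\<forall>i<length ns. \<exists>a'<ns ! i. 2 * cycle_dist (ns ! i) (p ! i) a' = ns ! i"
    using assms torus_nth cycle_dist_antipode by (metis nth_mem)
  then obtain h where h: "\<And>i. i < length ns \<Longrightarrow> h i < ns ! i \<and> 2 * cycle_dist (ns ! i) (p ! i) (h i) = ns ! i"
    by metis
  let ?p' = "map h [0..<length ns]"
  have p': "?p' \<in> torus_verts ns" using h by (simp add: torus_verts_def)
  have "torus_dist ns p q + torus_dist ns q ?p' = torus_dist ns p ?p'" if q: "q \<in> torus_verts ns" for q
    unfolding torus_dist_between[OF assms(1) p' q]
  proof (intro allI impI)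
    fix i assume i: "i < length ns"
    show "cycle_dist (ns ! i) (p ! i) (q ! i) + cycle_dist (ns ! i) (q ! i) (?p' ! i) = cycle_dist (ns ! i) (p ! i) (?p' ! i)"
      using cycle_dist_antipode_between[of "p ! i" "ns ! i" "h i" "q ! i"] h[OF i] i
        torus_nth[OF assms(1) i] torus_nth[OF q i] by simp
  qed
  with p' show ?thesis by blast
qed

text \<open>\<open>F_step\<close> says that the fixed points form an isometric subgraph.
  \<open>F_between\<close> is a local substitute for idempotence: intervals between fixed points are
  mapped to fixed points. In the application the former comes from the retract being isometric, the
  latter from \<open>f\<close> keeping such an interval inside the torus.\<close>

locale torus_map =
  fixes ns :: "nat list" and g :: "nat list \<Rightarrow> nat list" and F :: "nat list set"
  assumes ev: "\<And>i. i < length ns \<Longrightarrow> even (ns ! i) \<and> ns ! i \<ge> 6"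
    and g: "\<And>p. p \<in> torus_verts ns \<Longrightarrow> g p \<in> torus_verts ns"
    and nonexp: "\<And>p q. p \<in> torus_verts ns \<Longrightarrow> q \<in> torus_verts ns \<Longrightarrow> torus_dist ns (g p) (g q) \<le> torus_dist ns p q"
    and F_iff: "\<And>p. p \<in> F \<longleftrightarrow> p \<in> torus_verts ns \<and> g p = p"
    and F_step: "\<And>p q. p \<in> F \<Longrightarrow> q \<in> F \<Longrightarrow> p \<noteq> q \<Longrightarrow>
      \<exists>r\<in>F. torus_dist ns p r = 1 \<and> torus_dist ns p q = Suc (torus_dist ns r q)"
    and F_between: "\<And>p q r. p \<in> F \<Longrightarrow> q \<in> F \<Longrightarrow> r \<in> torus_verts ns \<Longrightarrow>
      torus_dist ns p r + torus_dist ns r q = torus_dist ns p q \<Longrightarrow> g (g r) = g r"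
begin

lemma F_torus: "p \<in> F \<Longrightarrow> p \<in> torus_verts ns"
  using F_iff by blast

lemma F_nonexp: "p \<in> F \<Longrightarrow> q \<in> torus_verts ns \<Longrightarrow> torus_dist ns (g q) p \<le> torus_dist ns q p"
  using nonexp[of q p] F_iff by simp

section \<open>Fixed cycles and their propagation\<close>

definition fibre :: "nat \<Rightarrow> nat list \<Rightarrow> bool" where
  "fibre i p \<longleftrightarrow> (\<forall>t<ns ! i. p[i := t] \<in> F)"

text \<open>Neither distance to the fixed ends can grow, and by the triangle inequality their sum
  cannot shrink.\<close>

lemma image_between:
  assumes "p \<in> F" "q \<in> F" "r \<in> torus_verts ns" "torus_dist ns p r + torus_dist ns r q = torus_dist ns p q"
  shows "torus_dist ns p (g r) = torus_dist ns p r" "torus_dist ns (g r) q = torus_dist ns r q"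
proof -
  have "torus_dist ns (g r) p \<le> torus_dist ns r p" "torus_dist ns (g r) q \<le> torus_dist ns r q" using F_nonexp assms by auto
  moreover have "torus_dist ns p q \<le> torus_dist ns p (g r) + torus_dist ns (g r) q"
    using assms F_torus g by (intro torus_dist_triangle) auto
  ultimately show "torus_dist ns p (g r) = torus_dist ns p r" "torus_dist ns (g r) q = torus_dist ns r q"
    using assms(4) torus_dist_commute[of ns p] by auto
qed

text \<open>Geodesics inside a single cycle between non-antipodal points are unique, so \<open>g\<close> fixes them.\<close>

lemma geodesic_fixed:
  assumes i: "i < length ns" and p: "p \<in> F" and q: "p[i := c] \<in> F"
    and t: "t < ns ! i" "c < ns ! i" "2 * cycle_dist (ns ! i) (p ! i) c < ns ! i"
      "cycle_dist (ns ! i) (p ! i) t + cycle_dist (ns ! i) t c = cycle_dist (ns ! i) (p ! i) c"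
  shows "p[i := t] \<in> F"
proof -
  let ?N = "ns ! i" and ?r = "p[i := t]" and ?q = "p[i := c]"
  let ?v = "g ?r"
  have pT: "p \<in> torus_verts ns" and len: "length p = length ns" using p F_torus torus_length by auto
  have rT: "?r \<in> torus_verts ns" using pT t(1) by (rule torus_update)
  have vT: "?v \<in> torus_verts ns" using rT g by blast
  have d: "torus_dist ns p ?r = cycle_dist ?N (p ! i) t" "torus_dist ns ?r ?q = cycle_dist ?N t c" "torus_dist ns p ?q = cycle_dist ?N (p ! i) c"
    using i len by (simp_all add: torus_dist_split)
  note im = image_between[OF p q rT, unfolded d, OF t(4)]
  have "torus_dist ns p ?v + torus_dist ns ?v ?q = torus_dist ns p ?q" using im t(4) d by simp
  then have b: "\<And>j. j < length ns \<Longrightarrow>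
      cycle_dist (ns ! j) (p ! j) (?v ! j) + cycle_dist (ns ! j) (?v ! j) (?q ! j) = cycle_dist (ns ! j) (p ! j) (?q ! j)"
    using torus_dist_between[OF pT F_torus[OF q] vT] by blast
  have eq: "?v ! j = p ! j" if j: "j < length ns" "j \<noteq> i" for j
    using b[OF j(1)] j cycle_dist_eq_0[of "p ! j" "ns ! j" "?v ! j"] torus_nth[OF pT j(1)] torus_nth[OF vT j(1)] by simp
  have vi: "?v ! i < ?N" using torus_nth vT i by blast
  have "off_dist ns i p ?v = 0" unfolding off_dist_def using eq by simp
  then have "cycle_dist ?N (p ! i) (?v ! i) = cycle_dist ?N (p ! i) t" using im(1) torus_dist_split[OF i, of p ?v] by simp
  moreover have "cycle_dist ?N (p ! i) (?v ! i) + cycle_dist ?N (?v ! i) c = cycle_dist ?N (p ! i) c" using b[OF i] i len by simp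
  ultimately have "?v ! i = t"
    using cycle_dist_unique[OF torus_nth[OF pT i] t(2) vi t(1) t(3)] t(4) by simp
  then have "?v = ?r"
    using eq i len by (intro torus_eqI[OF vT rT]) (auto simp: nth_list_update)
  with rT show ?thesis using F_iff by blast
qed

text \<open>The three geodesics between the fixed corners cover the cycle, and each is fixed
  pointwise.\<close>

lemma fibre_of_triangle:
  assumes i: "i < length ns" and p: "p \<in> F" "p[i := a] \<in> F" "p[i := b] \<in> F" "a < ns ! i" "b < ns ! i"
    and per: "cycle_dist (ns ! i) (p ! i) a + cycle_dist (ns ! i) a b + cycle_dist (ns ! i) b (p ! i) = ns ! i"
      "2 * cycle_dist (ns ! i) (p ! i) a < ns ! i" "2 * cycle_dist (ns ! i) a b < ns ! i" "2 * cycle_dist (ns ! i) b (p ! i) < ns ! i"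
  shows "fibre i p"
  unfolding fibre_def
proof (intro allI impI)
  fix t assume t: "t < ns ! i"
  have len: "length p = length ns" using p F_torus torus_length by auto
  have pi: "p ! i < ns ! i" using p(1) F_torus torus_nth i by blast
  from cycle_dist_cover[OF pi p(4,5) t per] show "p[i := t] \<in> F"
  proof (elim disjE)
    assume "cycle_dist (ns ! i) (p ! i) t + cycle_dist (ns ! i) t a = cycle_dist (ns ! i) (p ! i) a"
    then show ?thesis using geodesic_fixed[OF i p(1,2) t p(4) per(2)] by blast
  next
    assume "cycle_dist (ns ! i) a t + cycle_dist (ns ! i) t b = cycle_dist (ns ! i) a b"
    then show ?thesis
      using geodesic_fixed[OF i p(2), of b t] p(3,5) t per(3) i len by simp
  next
    assume "cycle_dist (ns ! i) b t + cycle_dist (ns ! i) t (p ! i) = cycle_dist (ns ! i) b (p ! i)"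
    then show ?thesis
      using geodesic_fixed[OF i p(3), of "p ! i" t] p(1) pi t per(4) i len by simp
  qed
qed

text \<open>If a cycle is fixed and an adjacent parallel cycle contains a fixed point \<open>p\<close>, then the
  antipode of \<open>p\<close> in the second cycle cannot be pulled off it without tearing the cycle.\<close>

lemma fibre_step:
  assumes i: "i < length ns" and x0: "x0 \<in> F" "fibre i x0" and p: "p \<in> F" and r1: "off_dist ns i x0 p = 1"
  shows "fibre i p"
proof -
  define N where "N = ns ! i"
  define P where "P = p ! i"
  define v where "v t = g (p[i := t])" for t
  have N: "even N" "N \<ge> 6" using ev i by (auto simp: N_def)
  have pT: "p \<in> torus_verts ns" and xT: "x0 \<in> torus_verts ns" using p x0 F_torus by auto
  have len: "length p = length ns" "length x0 = length ns" using pT xT torus_length by auto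
  have P: "P < N" using torus_nth pT i by (simp add: P_def N_def)
  have ptT: "p[i := t] \<in> torus_verts ns" if "t < N" for t
    using torus_update pT that by (simp add: N_def)
  have vT: "v t \<in> torus_verts ns" if "t < N" for t using ptT[OF that] g by (simp add: v_def)
  have vN: "v t ! i < N" if "t < N" for t using vT[OF that] torus_nth i by (simp add: N_def)
  \<comment> \<open>Test against the point of the fixed cycle whose coordinate \<open>c\<close> is
    antipodal to that of \<open>v t\<close>: any drift along the cycle shows up there in full, and
    the distance 1 between the cycles bounds it.\<close>
  have A: "cycle_dist N t (v t ! i) + off_dist ns i (v t) x0 \<le> 1" if t: "t < N" for t
  proof -
    obtain c where c: "c < N" "2 * cycle_dist N (v t ! i) c = N" using cycle_dist_antipode[OF N(1) vN[OF t]] by blast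
    have "x0[i := c] \<in> F" using x0 c by (simp add: fibre_def N_def)
    then have "torus_dist ns (v t) (x0[i := c]) \<le> torus_dist ns (p[i := t]) (x0[i := c])"
      using F_nonexp ptT[OF t] by (simp add: v_def)
    then have "cycle_dist N (v t ! i) c + off_dist ns i (v t) x0 \<le> cycle_dist N t c + 1"
      using r1 i len off_dist_commute[of ns i x0 p] by (simp add: torus_dist_split N_def)
    with cycle_dist_antipode_between[OF vN[OF t] c(1) t c(2)] show ?thesis using cycle_dist_commute[of N t "v t ! i"] by linarith
  qed
  have B: "cycle_dist N (v t ! i) P + off_dist ns i (v t) p \<le> cycle_dist N t P" if t: "t < N" for t
  proof -
    have "torus_dist ns (v t) p \<le> torus_dist ns (p[i := t]) p" using F_nonexp[OF p ptT[OF t]] by (simp add: v_def)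
    then show ?thesis using i len by (simp add: torus_dist_split N_def P_def)
  qed
  have C: "1 \<le> off_dist ns i (v t) x0 + off_dist ns i (v t) p" if t: "t < N" for t
    using off_dist_triangle[OF xT pT vT[OF t], of i] r1 off_dist_commute[of ns i x0 "v t"] by simp
  have D: "cycle_dist N (v t ! i) (v s ! i) \<le> cycle_dist N t s" if "t < N" "s < N" for t s
  proof -
    have "torus_dist ns (v t) (v s) \<le> torus_dist ns (p[i := t]) (p[i := s])"
      using nonexp ptT that by (simp add: v_def)
    then show ?thesis using i len by (simp add: torus_dist_split N_def)
  qed
  \<comment> \<open>A drift exhausts the bound \<open>A\<close>, so \<open>v t\<close> projects onto
    \<open>x0\<close>. It has then left the cycle of \<open>p\<close>, and by \<open>B\<close> it
    must pay for that by coming closer to \<open>P\<close>.\<close>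
  have off: "cycle_dist N t (v t ! i) = 1 \<and> cycle_dist N (v t ! i) P < cycle_dist N t P" if t: "t < N" and "v t ! i \<noteq> t" for t
  proof -
    have "cycle_dist N t (v t ! i) \<noteq> 0" using cycle_dist_eq_0[OF t vN[OF t]] that(2) by simp
    with A[OF t] B[OF t] C[OF t] show ?thesis by linarith
  qed
  obtain c where c: "c < N" "2 * cycle_dist N P c = N" using cycle_dist_antipode[OF N(1) P] by blast
  have vc: "v c ! i = c"
  proof (rule ccontr)
    assume n: "v c ! i \<noteq> c"
    obtain t where t: "t < N" "cycle_dist N t c = 1" "cycle_dist N t (v c ! i) = 2"
      "\<forall>w<N. cycle_dist N t w = 1 \<longrightarrow> cycle_dist N w P < cycle_dist N t P \<longrightarrow> cycle_dist N w (v c ! i) \<ge> 2"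
      using cycle_dist_two_neighbours[OF N(2) P c(1) vN[OF c(1)] c(2)] off[OF c(1) n] by blast
    have "cycle_dist N (v t ! i) (v c ! i) \<ge> 2"
    proof (cases "v t ! i = t")
      case True
      with t(3) show ?thesis by simp
    next
      case False
      with off[OF t(1)] t(4) vN[OF t(1)] show ?thesis by blast
    qed
    with D[OF t(1) c(1)] t(2) show False by simp
  qed
  \<comment> \<open>With the antipode \<open>c\<close> of \<open>P\<close> held in place, coming
    closer to \<open>P\<close> would mean receding from \<open>c\<close>.\<close>
  have vt: "v t ! i = t" if t: "t < N" for t
  proof (rule ccontr)
    assume "v t ! i \<noteq> t"
    with off t have "cycle_dist N (v t ! i) P < cycle_dist N t P" by blast
    moreover have "cycle_dist N (v t ! i) c \<le> cycle_dist N t c" using D[OF t c(1)] vc by simp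
    ultimately show False
      using cycle_dist_antipode_between[OF P c(1) t c(2)] cycle_dist_antipode_between[OF P c(1) vN[OF t] c(2)]
        cycle_dist_commute[of N P] by simp
  qed
  have "p[i := t] \<in> F" if t: "t < N" for t
  proof -
    have "off_dist ns i (v t) p = 0" using B[OF t] vt[OF t] by simp
    then have "v t ! j = p ! j" if "j < length ns" "j \<noteq> i" for j
      using off_dist_eq_0[OF vT[OF t] pT] that by blast
    then have "v t = p[i := t]"
      using vt[OF t] i len by (intro torus_eqI[OF vT[OF t] ptT[OF t]]) (auto simp: nth_list_update)
    then show ?thesis using ptT[OF t] F_iff by (simp add: v_def)
  qed
  then show ?thesis by (simp add: fibre_def N_def)
qed

text \<open>Walk a geodesic inside \<open>F\<close> from \<open>p\<close> to \<open>x\<close>. Each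
  edge either stays in an \<open>i\<close>-cycle, or joins two adjacent parallel ones, where
  \<open>fibre_step\<close> applies.\<close>

lemma fibre_all:
  assumes i: "i < length ns" and x: "x \<in> F" "fibre i x" and p: "p \<in> F"
  shows "fibre i p"
  using p
proof (induction "torus_dist ns p x" arbitrary: p)
  case 0
  then have "p = x" using torus_dist_eq_0 F_torus x by simp
  with x show ?case by simp
next
  case (Suc n)
  then have "p \<noteq> x" by auto
  then obtain r where r: "r \<in> F" "torus_dist ns p r = 1" "torus_dist ns p x = Suc (torus_dist ns r x)"
    using F_step[OF Suc.prems x(1)] by blast
  then have fr: "fibre i r" using Suc by simp
  have T: "p \<in> torus_verts ns" "r \<in> torus_verts ns" using F_torus r Suc by auto
  have "off_dist ns i p r \<le> 1" using r(2) torus_dist_split[OF i, of p r] by simp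
  then consider "off_dist ns i p r = 0" | "off_dist ns i r p = 1" using off_dist_commute[of ns i p r] by linarith
  then show ?case
  proof cases
    case 1
    then have "p[i := t] = r[i := t]" if "t < ns ! i" for t
      using off_dist_eq_0[OF T 1] T torus_length i that
      by (intro torus_eqI[OF torus_update[OF T(1) that] torus_update[OF T(2) that]])
        (auto simp: nth_list_update)
    with fr show ?thesis by (simp add: fibre_def)
  next
    case 2
    then show ?thesis using fibre_step[OF i r(1) fr Suc.prems] by blast
  qed
qed

text \<open>\<open>J\<close> holds the factors not yet split off; \<open>mix J x y\<close> is the
  corner \<open>y\<close> projected to the subtorus through \<open>x\<close> spanned by
  them.\<close>

definition mix :: "nat set \<Rightarrow> nat list \<Rightarrow> nat list \<Rightarrow> nat list" where
  "mix J x y = map (\<lambda>i. if i \<in> J then y ! i else x ! i) [0..<length ns]"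

lemma mix_nth: "i < length ns \<Longrightarrow> mix J x y ! i = (if i \<in> J then y ! i else x ! i)"
  by (simp add: mix_def)

lemma length_mix [simp]: "length (mix J x y) = length ns"
  by (simp add: mix_def)

lemma mix_torus: "x \<in> torus_verts ns \<Longrightarrow> y \<in> torus_verts ns \<Longrightarrow> mix J x y \<in> torus_verts ns"
  by (simp add: torus_verts_def mix_def)

lemma mix_remove:
  "x \<in> torus_verts ns \<Longrightarrow> y \<in> torus_verts ns \<Longrightarrow> i < length ns \<Longrightarrow> mix (J - {i}) x y = (mix J x y)[i := x ! i]"
  by (intro torus_eqI[of _ ns] torus_update mix_torus) (auto simp: mix_nth torus_nth nth_list_update)

text \<open>The pushed point lies between the fixed points \<open>x\<close> and
  \<open>mix J x y\<close>, so its image \<open>a\<close> is fixed and keeps its distances to both.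
  This places \<open>a\<close> between them in every factor, but does not yet say in which factors
  \<open>a\<close> differs from \<open>x\<close>.\<close>

lemma pull_along_factor:
  assumes x: "x \<in> F" and y: "y \<in> torus_verts ns" and m: "mix J x y \<in> F" and l: "l \<in> J" "l < length ns"
  defines "a \<equiv> g (x[l := y ! l])"
  shows "a \<in> F" "torus_dist ns x a = cycle_dist (ns ! l) (x ! l) (y ! l)"
    "\<And>i. i < length ns \<Longrightarrow> i \<in> J \<Longrightarrow>
      cycle_dist (ns ! i) (x ! i) (a ! i) + cycle_dist (ns ! i) (a ! i) (y ! i) = cycle_dist (ns ! i) (x ! i) (y ! i)"
    "\<And>i. i < length ns \<Longrightarrow> i \<notin> J \<Longrightarrow> a ! i = x ! i"
proof -
  let ?q = "x[l := y ! l]"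
  have xT: "x \<in> torus_verts ns" and mT: "mix J x y \<in> torus_verts ns" using x m F_torus by auto
  have qT: "?q \<in> torus_verts ns" using torus_update[OF xT] torus_nth[OF y l(2)] by blast
  have aT: "a \<in> torus_verts ns" using g qT by (simp add: a_def)
  have len: "length x = length ns" using xT torus_length by blast
  have b: "torus_dist ns x ?q + torus_dist ns ?q (mix J x y) = torus_dist ns x (mix J x y)"
    unfolding torus_dist_between[OF xT mT qT] using l len by (auto simp: nth_list_update mix_nth)
  show "a \<in> F" using F_between[OF x m qT b] aT F_iff by (simp add: a_def)
  note im = image_between[OF x m qT b]
  have "torus_dist ns x ?q = cycle_dist (ns ! l) (x ! l) (y ! l)" using torus_dist_update[OF xT l(2)] by blast
  then show "torus_dist ns x a = cycle_dist (ns ! l) (x ! l) (y ! l)" using im(1) by (simp add: a_def)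
  have "torus_dist ns x a + torus_dist ns a (mix J x y) = torus_dist ns x (mix J x y)"
    using im b by (simp add: a_def)
  then have c: "\<And>i. i < length ns \<Longrightarrow> cycle_dist (ns ! i) (x ! i) (a ! i) + cycle_dist (ns ! i) (a ! i) (mix J x y ! i)
      = cycle_dist (ns ! i) (x ! i) (mix J x y ! i)"
    using torus_dist_between[OF xT mT aT] by blast
  show "cycle_dist (ns ! i) (x ! i) (a ! i) + cycle_dist (ns ! i) (a ! i) (y ! i) = cycle_dist (ns ! i) (x ! i) (y ! i)"
    if "i < length ns" "i \<in> J" for i using c[OF that(1)] that by (simp add: mix_nth)
  show "a ! i = x ! i" if "i < length ns" "i \<notin> J" for i
    using c[OF that(1)] that cycle_dist_eq_0[OF torus_nth[OF xT that(1)] torus_nth[OF aT that(1)]]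
    by (simp add: mix_nth)
qed

text \<open>Push \<open>x\<close> along a shortest factor \<open>l\<close> towards \<open>y\<close> and towards \<open>z\<close>. The images under \<open>g\<close> are
  too close to each other unless both pushes happen in one single factor, of the same length.\<close>

lemma fibre_exists:
  assumes x: "x \<in> F" and y: "y \<in> torus_verts ns" and z: "z \<in> torus_verts ns"
    and my: "mix J x y \<in> F" and mz: "mix J x z \<in> F"
    and J: "J \<subseteq> {..<length ns}" "J \<noteq> {}"
    and per: "\<And>i. i < length ns \<Longrightarrow> cycle_dist (ns ! i) (x ! i) (y ! i) + cycle_dist (ns ! i) (y ! i) (z ! i)
        + cycle_dist (ns ! i) (z ! i) (x ! i) = ns ! i"
      "\<And>i. i < length ns \<Longrightarrow> 2 * cycle_dist (ns ! i) (x ! i) (y ! i) < ns ! i \<and>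
        2 * cycle_dist (ns ! i) (y ! i) (z ! i) < ns ! i \<and> 2 * cycle_dist (ns ! i) (z ! i) (x ! i) < ns ! i"
  shows "\<exists>i\<in>J. fibre i x"
proof -
  obtain l where l: "l \<in> J" "\<And>i. i \<in> J \<Longrightarrow> ns ! l \<le> ns ! i"
    using ex_has_least_nat[of "\<lambda>i. i \<in> J" _ "\<lambda>i. ns ! i"] J(2) by (meson ex_in_conv)
  then have lk: "l < length ns" using J by blast
  define a where "a = g (x[l := y ! l])"
  define b where "b = g (x[l := z ! l])"
  note a = pull_along_factor[OF x y my l(1) lk, folded a_def]
  note b = pull_along_factor[OF x z mz l(1) lk, folded b_def]
  have xT: "x \<in> torus_verts ns" and aT: "a \<in> torus_verts ns" and bT: "b \<in> torus_verts ns"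
    using x a(1) b(1) F_torus by auto
  have len: "length x = length ns" using xT torus_length by blast
  define A where "A i = cycle_dist (ns ! i) (x ! i) (a ! i)" for i
  define B where "B i = cycle_dist (ns ! i) (x ! i) (b ! i)" for i
  define SA where "SA = cycle_dist (ns ! l) (x ! l) (y ! l)"
  define SB where "SB = cycle_dist (ns ! l) (x ! l) (z ! l)"
  define S where "S = cycle_dist (ns ! l) (y ! l) (z ! l)"
  have sum: "SA + SB + S = ns ! l" "2 * SA < ns ! l" "2 * SB < ns ! l" "2 * S < ns ! l"
    using per[OF lk] cycle_dist_commute[of "ns ! l" "x ! l" "z ! l"] by (simp_all add: SA_def SB_def S_def)
  have sA: "(\<Sum>i<length ns. A i) = SA" using a(2) by (simp add: torus_dist_def A_def SA_def)
  have sB: "(\<Sum>i<length ns. B i) = SB" using b(2) by (simp add: torus_dist_def B_def SB_def)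
  have "torus_dist ns a b \<le> torus_dist ns (x[l := y ! l]) (x[l := z ! l])"
    unfolding a_def b_def
    using nonexp torus_update[OF xT] torus_nth[OF y lk] torus_nth[OF z lk] by blast
  also have "\<dots> = S" using lk len by (simp add: torus_dist_split S_def)
  finally have ab: "torus_dist ns a b \<le> S" .
  have min: "cycle_dist (ns ! i) (a ! i) (b ! i) = min (A i + B i) (ns ! i - (A i + B i))" if i: "i < length ns" for i
  proof (cases "i \<in> J")
    case True
    have q: "2 * cycle_dist (ns ! i) (x ! i) (y ! i) < ns ! i" "2 * cycle_dist (ns ! i) (y ! i) (z ! i) < ns ! i"
      "2 * cycle_dist (ns ! i) (z ! i) (x ! i) < ns ! i" using per(2)[OF i] by auto
    show ?thesis unfolding A_def B_def
      by (rule cycle_dist_opposite[OF torus_nth[OF xT i] torus_nth[OF y i] torus_nth[OF z i] torus_nth[OF aT i]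
          torus_nth[OF bT i] per(1)[OF i] q a(3)[OF i True] b(3)[OF i True]])
  next
    case False
    then have "a ! i = x ! i" "b ! i = x ! i" using a(4) b(4) i by auto
    then show ?thesis by (simp add: A_def B_def)
  qed
  \<comment> \<open>If going through \<open>x\<close> were shortest in all factors, \<open>a\<close>
    and \<open>b\<close> would be \<open>SA + SB\<close> apart. This exceeds \<open>S\<close>, since
    \<open>S\<close> is below half of the cycle and the three add up to it.\<close>
  have "\<exists>i<length ns. \<not> 2 * (A i + B i) \<le> ns ! i"
  proof (rule ccontr)
    assume "\<not> ?thesis"
    then have "cycle_dist (ns ! i) (a ! i) (b ! i) = A i + B i" if "i < length ns" for i
      using min[OF that] that by fastforce
    then have "torus_dist ns a b = SA + SB" using sA sB by (simp add: torus_dist_def sum.distrib)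
    with ab sum show False by linarith
  qed
  then obtain i where i: "i < length ns" "ns ! i < 2 * (A i + B i)" by auto
  have iJ: "i \<in> J"
  proof (rule ccontr)
    assume "i \<notin> J"
    then have "A i = 0" "B i = 0" using a(4) b(4) i by (auto simp: A_def B_def)
    with i show False by simp
  qed
  have le: "A i \<le> SA" "B i \<le> SB"
    using member_le_sum[of i "{..<length ns}" A] member_le_sum[of i "{..<length ns}" B] i(1) sA sB by auto
  have cdi: "cycle_dist (ns ! i) (a ! i) (b ! i) = ns ! i - (A i + B i)" using min[OF i(1)] i(2) by simp
  have "cycle_dist (ns ! i) (a ! i) (b ! i) \<le> S" using ab torus_dist_split[OF i(1), of a b] by simp
  \<comment> \<open>Going around gives
    \<open>ns ! i - (A i + B i) \<le> S = ns ! l - (SA + SB)\<close>. As \<open>ns ! l\<close> is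
    minimal and \<open>A i\<close>, \<open>B i\<close> are at most \<open>SA\<close>,
    \<open>SB\<close>, all three inequalities are equalities, so both displacements lie wholly in
    factor \<open>i\<close>.\<close>
  then have eq: "A i = SA" "B i = SB" "ns ! i = ns ! l"
    using cdi le sum l(2)[OF iJ] by linarith+
  have "a = x[i := a ! i]"
  proof (rule torus_eqI[OF aT torus_update[OF xT torus_nth[OF aT i(1)]]])
    fix j assume j: "j < length ns"
    have "A j = 0" if "j \<noteq> i"
      using sum.remove[of "{..<length ns}" i A] i(1) sA eq(1) that j by simp
    then show "a ! j = x[i := a ! i] ! j"
      using j len cycle_dist_eq_0[OF torus_nth[OF xT j] torus_nth[OF aT j]]
      by (cases "j = i") (auto simp: A_def)
  qed
  moreover have "b = x[i := b ! i]"
  proof (rule torus_eqI[OF bT torus_update[OF xT torus_nth[OF bT i(1)]]])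
    fix j assume j: "j < length ns"
    have "B j = 0" if "j \<noteq> i"
      using sum.remove[of "{..<length ns}" i B] i(1) sB eq(2) that j by simp
    then show "b ! j = x[i := b ! i] ! j"
      using j len cycle_dist_eq_0[OF torus_nth[OF xT j] torus_nth[OF bT j]]
      by (cases "j = i") (auto simp: B_def)
  qed
  ultimately have F2: "x[i := a ! i] \<in> F" "x[i := b ! i] \<in> F" using a(1) b(1) by simp_all
  have "fibre i x"
  proof (rule fibre_of_triangle[OF i(1) x F2 torus_nth[OF aT i(1)] torus_nth[OF bT i(1)]])
    show "cycle_dist (ns ! i) (x ! i) (a ! i) + cycle_dist (ns ! i) (a ! i) (b ! i) + cycle_dist (ns ! i) (b ! i) (x ! i) = ns ! i"
      "2 * cycle_dist (ns ! i) (x ! i) (a ! i) < ns ! i" "2 * cycle_dist (ns ! i) (a ! i) (b ! i) < ns ! i"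
      "2 * cycle_dist (ns ! i) (b ! i) (x ! i) < ns ! i"
      using cdi eq sum cycle_dist_commute[of "ns ! i" "b ! i" "x ! i"] by (simp_all add: A_def B_def)
  qed
  with iJ show ?thesis by blast
qed

text \<open>Induction on the set \<open>J\<close> of factors in which \<open>t\<close> may differ
  from \<open>x\<close>. Once one \<open>i\<close>-cycle through \<open>x\<close> is fixed, every
  fixed point has a fixed \<open>i\<close>-cycle: coordinate \<open>i\<close> can be reset to that
  of \<open>x\<close> in both projected corners, and restored in \<open>t\<close>
  afterwards.\<close>

lemma fixed_all:
  assumes x: "x \<in> F" and y: "y \<in> F" and z: "z \<in> F"
    and per: "\<And>i. i < length ns \<Longrightarrow> cycle_dist (ns ! i) (x ! i) (y ! i) + cycle_dist (ns ! i) (y ! i) (z ! i)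
        + cycle_dist (ns ! i) (z ! i) (x ! i) = ns ! i"
      "\<And>i. i < length ns \<Longrightarrow> 2 * cycle_dist (ns ! i) (x ! i) (y ! i) < ns ! i \<and>
        2 * cycle_dist (ns ! i) (y ! i) (z ! i) < ns ! i \<and> 2 * cycle_dist (ns ! i) (z ! i) (x ! i) < ns ! i"
  shows "torus_verts ns \<subseteq> F"
proof -
  have T: "x \<in> torus_verts ns" "y \<in> torus_verts ns" "z \<in> torus_verts ns" using x y z F_torus by auto
  have key: "t \<in> F" if "J \<subseteq> {..<length ns}" "mix J x y \<in> F" "mix J x z \<in> F" "t \<in> torus_verts ns"
    "\<And>i. i < length ns \<Longrightarrow> i \<notin> J \<Longrightarrow> t ! i = x ! i" for J t
    using that
  proof (induction "card J" arbitrary: J t)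
    case 0
    then have "J = {}" using finite_subset[OF 0(2)] by simp
    then have "t = x" using 0 T by (intro torus_eqI) auto
    with x show ?case by simp
  next
    case (Suc n)
    then have "J \<noteq> {}" by auto
    then obtain i where i: "i \<in> J" "fibre i x"
      using fibre_exists[OF x T(2,3) Suc.prems(2,3,1) _ per] by blast
    then have il: "i < length ns" using Suc.prems(1) by blast
    note fib = fibre_all[OF il x i(2)]
    have xi: "x ! i < ns ! i" using torus_nth T il by blast
    have t': "t[i := x ! i] \<in> F"
    proof (rule Suc.hyps(1))
      show "n = card (J - {i})" using Suc.hyps(2) i(1) by simp
      show "J - {i} \<subseteq> {..<length ns}" using Suc.prems(1) by blast
      show "mix (J - {i}) x y \<in> F" "mix (J - {i}) x z \<in> F"
        using fib[OF Suc.prems(2)] fib[OF Suc.prems(3)] xi mix_remove[OF _ _ il] T by (simp_all add: fibre_def)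
      show "t[i := x ! i] \<in> torus_verts ns" using torus_update Suc.prems(4) xi by blast
      show "t[i := x ! i] ! j = x ! j" if "j < length ns" "j \<notin> J - {i}" for j
        using that Suc.prems(4,5) torus_length by (cases "j = i") auto
    qed
    have "t ! i < ns ! i" using torus_nth Suc.prems(4) il by blast
    moreover have "\<forall>c<ns ! i. t[i := x ! i, i := c] \<in> F" using fib[OF t'] unfolding fibre_def .
    ultimately have "t[i := x ! i, i := t ! i] \<in> F" by blast
    then show ?case by simp
  qed
  show ?thesis
  proof
    fix t assume t: "t \<in> torus_verts ns"
    have "mix {..<length ns} x y = y" "mix {..<length ns} x z = z"
      using T by (auto intro!: torus_eqI[OF mix_torus] simp: mix_nth)
    then show "t \<in> F" using key[of "{..<length ns}" t] t y z by simp
  qed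
qed

end

section \<open>Retracts\<close>

context pcube
begin

section \<open>Hulls and hypertori inside a partial cube\<close>

lemma co_least: "convex V E C \<Longrightarrow> S \<subseteq> C \<Longrightarrow> co V E S \<subseteq> C"
  unfolding co_def by blast

lemma co_superset: "S \<subseteq> co V E S"
  unfolding co_def by blast

lemma convex_co:
  assumes "S \<subseteq> V"
  shows "convex V E (co V E S)"
proof -
  have "convex V E V" unfolding convex_btw by blast
  then have "co V E S \<subseteq> V" using co_least assms by blast
  moreover have "z \<in> co V E S" if "x \<in> co V E S" "y \<in> co V E S" "z \<in> V" "btw x z y" for x y z
  proof -
    have "z \<in> C" if C: "convex V E C" "S \<subseteq> C" for C
    proof -
      have "x \<in> C" "y \<in> C" using co_least[OF C] \<open>x \<in> co V E S\<close> \<open>y \<in> co V E S\<close> by blast+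
      with C(1) \<open>z \<in> V\<close> \<open>btw x z y\<close> show ?thesis unfolding convex_btw by blast
    qed
    then show ?thesis unfolding co_def by blast
  qed
  ultimately show ?thesis unfolding convex_btw by blast
qed

lemma co_agree:
  assumes "S \<subseteq> V" "\<And>s. s \<in> S \<Longrightarrow> (e \<in> \<psi> s \<longleftrightarrow> P)" "v \<in> co V E S"
  shows "e \<in> \<psi> v \<longleftrightarrow> P"
proof -
  have "convex V E {v \<in> V. e \<in> \<psi> v \<longleftrightarrow> P}" unfolding convex_btw btw_def by blast
  then have "co V E S \<subseteq> {v \<in> V. e \<in> \<psi> v \<longleftrightarrow> P}" by (rule co_least) (use assms in auto)
  with assms(3) show ?thesis by blast
qed

lemma finite_co:
  assumes "finite S" "S \<subseteq> V" "b \<in> S"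
  shows "finite (co V E S)"
proof -
  let ?K = "{v \<in> V. \<forall>e. (\<forall>t\<in>S. e \<in> \<psi> t \<longleftrightarrow> e \<in> \<psi> b) \<longrightarrow> (e \<in> \<psi> v \<longleftrightarrow> e \<in> \<psi> b)}"
  have "convex V E ?K" unfolding convex_btw btw_def by blast
  moreover have "S \<subseteq> ?K" using assms(2) by blast
  ultimately have "co V E S \<subseteq> ?K" by (rule co_least)
  moreover have "finite ?K" using finite_psi_hull assms by blast
  ultimately show ?thesis by (rule finite_subset)
qed

lemma hypertorus_hdist:
  assumes T: "convex V E T" and \<phi>: "bij_betw \<phi> T (torus_verts ns)"
    and adj: "\<And>x y. x \<in> T \<Longrightarrow> y \<in> T \<Longrightarrow> induced E T x y \<longleftrightarrow> torus_adj ns (\<phi> x) (\<phi> y)"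
    and ns: "\<forall>n\<in>set ns. n \<ge> 2" and st: "s \<in> T" "t \<in> T"
  shows "hdist s t = torus_dist ns (\<phi> s) (\<phi> t)"
proof -
  interpret T: pcube T "induced E T" \<psi> using restrict_convex T .
  have im: "\<phi> u \<in> torus_verts ns" if "u \<in> T" for u using \<phi> that by (auto simp: bij_betw_def)
  have "gdist T (induced E T) s t = enat (torus_dist ns (\<phi> s) (\<phi> t))"
  proof (rule gdist_eqI[where D = "\<lambda>u. torus_dist ns (\<phi> u) (\<phi> t)"])
    fix u v assume uv: "induced E T u v" "u \<in> T" "v \<in> T"
    then have "torus_dist ns (\<phi> u) (\<phi> v) = 1" using torus_adj_torus_dist im adj ns by blast
    then show "torus_dist ns (\<phi> u) (\<phi> t) \<le> Suc (torus_dist ns (\<phi> v) (\<phi> t))"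
      using torus_dist_triangle[OF im[OF uv(2)] im[OF st(2)] im[OF uv(3)]] by simp
  next
    fix u assume u: "u \<in> T" "u \<noteq> t"
    then have "\<phi> u \<noteq> \<phi> t" using \<phi> st by (auto simp: bij_betw_def inj_on_def)
    then obtain r where r: "r \<in> torus_verts ns" "torus_adj ns (\<phi> u) r"
      "torus_dist ns (\<phi> u) (\<phi> t) = Suc (torus_dist ns r (\<phi> t))"
      using torus_step[OF im[OF u(1)] im[OF st(2)]] by blast
    then obtain v where "v \<in> T" "r = \<phi> v" using \<phi> by (auto simp: bij_betw_def)
    with r u adj show "\<exists>v\<in>T. induced E T u v \<and> torus_dist ns (\<phi> u) (\<phi> t) = Suc (torus_dist ns (\<phi> v) (\<phi> t))"
      by blast
  qed (use st in auto)
  then show ?thesis using T.gdist_hdist[OF st] by simp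
qed

lemma hypertorus_antipodal:
  assumes T: "convex V E T" and \<phi>: "bij_betw \<phi> T (torus_verts ns)"
    and d: "\<forall>s\<in>T. \<forall>t\<in>T. hdist s t = torus_dist ns (\<phi> s) (\<phi> t)" and ns: "\<forall>n\<in>set ns. even n"
  shows "antipodal T"
  unfolding antipodal_def
proof
  fix t assume t: "t \<in> T"
  have im: "\<phi> u \<in> torus_verts ns" if "u \<in> T" for u using \<phi> that by (auto simp: bij_betw_def)
  have TV: "T \<subseteq> V" using T by (simp add: convex_def)
  obtain p where p: "p \<in> torus_verts ns" "\<forall>q\<in>torus_verts ns. torus_dist ns (\<phi> t) q + torus_dist ns q p = torus_dist ns (\<phi> t) p"
    using torus_antipode[OF im[OF t] ns] by blast
  then obtain t' where t': "t' \<in> T" "p = \<phi> t'" using \<phi> by (auto simp: bij_betw_def)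
  have "btw t s t'" if s: "s \<in> T" for s
  proof -
    have "hdist t s + hdist s t' = hdist t t'" using d t t' s im p by simp
    with btw_iff_hdist TV t t' s show ?thesis by blast
  qed
  with t' show "\<exists>t'\<in>T. \<forall>s\<in>T. btw t s t'" by blast
qed

text \<open>Replacing coordinate \<open>i\<close> of the corner \<open>x\<close> by \<open>r\<close>
  gives a vertex lying between \<open>x\<close> and both other corners, hence \<open>x\<close>
  itself. The corner condition thus descends to every factor.\<close>

lemma corner_factor:
  assumes T: "convex V E T" and \<phi>: "bij_betw \<phi> T (torus_verts ns)"
    and d: "\<forall>s\<in>T. \<forall>t\<in>T. hdist s t = torus_dist ns (\<phi> s) (\<phi> t)"
    and xyz: "x \<in> T" "y \<in> T" "z \<in> T" and c: "interval V E x y \<inter> interval V E x z = {x}"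
    and i: "i < length ns" "r < ns ! i"
      "cycle_dist (ns ! i) (\<phi> x ! i) r + cycle_dist (ns ! i) r (\<phi> y ! i) = cycle_dist (ns ! i) (\<phi> x ! i) (\<phi> y ! i)"
      "cycle_dist (ns ! i) (\<phi> x ! i) r + cycle_dist (ns ! i) r (\<phi> z ! i) = cycle_dist (ns ! i) (\<phi> x ! i) (\<phi> z ! i)"
  shows "r = \<phi> x ! i"
proof -
  have im: "\<phi> u \<in> torus_verts ns" if "u \<in> T" for u using \<phi> that by (auto simp: bij_betw_def)
  have TV: "T \<subseteq> V" using T by (simp add: convex_def)
  have len: "length (\<phi> x) = length ns" using im xyz torus_length by blast
  have "(\<phi> x)[i := r] \<in> torus_verts ns" using torus_update im xyz i by blast
  then obtain v where v: "v \<in> T" "\<phi> v = (\<phi> x)[i := r]"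
    using \<phi> unfolding bij_betw_def by (metis imageE)
  have b: "btw x v w" if w: "w \<in> T"
    "cycle_dist (ns ! i) (\<phi> x ! i) r + cycle_dist (ns ! i) r (\<phi> w ! i) = cycle_dist (ns ! i) (\<phi> x ! i) (\<phi> w ! i)" for w
  proof -
    have "hdist x v + hdist v w = hdist x w"
      using w v d xyz(1) i len by (simp add: torus_dist_split[OF i(1)])
    then show ?thesis using btw_iff_hdist TV xyz(1) v(1) w(1) by blast
  qed
  have V: "x \<in> V" "y \<in> V" "z \<in> V" "v \<in> V" using xyz v TV by auto
  have "v \<in> interval V E x y \<inter> interval V E x z"
    using b[OF xyz(2) i(3)] b[OF xyz(3) i(4)] V by (simp add: interval_btw)
  then have "v = x" using c by blast
  then have "(\<phi> x)[i := r] ! i = \<phi> x ! i" using v(2) by metis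
  then show ?thesis using i(1) len by simp
qed

text \<open>On a cycle, either the three projections wind around it or one lies between the other
  two. In the second case the corner conditions make all three equal, which the hull being the whole
  torus forbids.\<close>

lemma triangle_factors:
  assumes T: "convex V E T" and \<phi>: "bij_betw \<phi> T (torus_verts ns)"
    and d: "\<forall>s\<in>T. \<forall>t\<in>T. hdist s t = torus_dist ns (\<phi> s) (\<phi> t)"
    and ns: "\<forall>n\<in>set ns. even n \<and> n \<ge> 4"
    and tri: "metric_triangle V E x y z" and Tco: "T = co V E {x, y, z}" and i: "i < length ns"
  shows "cycle_dist (ns ! i) (\<phi> x ! i) (\<phi> y ! i) + cycle_dist (ns ! i) (\<phi> y ! i) (\<phi> z ! i)
      + cycle_dist (ns ! i) (\<phi> z ! i) (\<phi> x ! i) = ns ! i"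
    "2 * cycle_dist (ns ! i) (\<phi> x ! i) (\<phi> y ! i) < ns ! i \<and> 2 * cycle_dist (ns ! i) (\<phi> y ! i) (\<phi> z ! i) < ns ! i \<and>
      2 * cycle_dist (ns ! i) (\<phi> z ! i) (\<phi> x ! i) < ns ! i"
    "ns ! i \<ge> 6"
proof -
  let ?N = "ns ! i" and ?x = "\<phi> x ! i" and ?y = "\<phi> y ! i" and ?z = "\<phi> z ! i"
  have im: "\<phi> u \<in> torus_verts ns" if "u \<in> T" for u using \<phi> that by (auto simp: bij_betw_def)
  have TV: "T \<subseteq> V" using T by (simp add: convex_def)
  have xyz: "x \<in> T" "y \<in> T" "z \<in> T" unfolding Tco using co_superset[of "{x, y, z}"] by auto
  have N: "even ?N" "?N \<ge> 4" using ns i nth_mem by blast+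
  have lt: "?x < ?N" "?y < ?N" "?z < ?N" using xyz im torus_nth i by auto
  \<comment> \<open>Equal projections would confine the hull to a convex slice of the torus, missing
    the points with another coordinate \<open>i\<close>.\<close>
  have sp: "\<not> (?x = ?y \<and> ?x = ?z)"
  proof
    assume eq: "?x = ?y \<and> ?x = ?z"
    have "convex V E {v \<in> T. \<phi> v ! i = ?x}"
      unfolding convex_btw
    proof (intro conjI ballI impI)
      fix p q r assume p: "p \<in> {v \<in> T. \<phi> v ! i = ?x}" and q: "q \<in> {v \<in> T. \<phi> v ! i = ?x}"
        and r: "r \<in> V" "btw p r q"
      have rT: "r \<in> T" using p q r T unfolding convex_btw by blast
      have "hdist p r + hdist r q = hdist p q" using r p q rT TV btw_iff_hdist by blast
      then have "torus_dist ns (\<phi> p) (\<phi> r) + torus_dist ns (\<phi> r) (\<phi> q) = torus_dist ns (\<phi> p) (\<phi> q)" using d p q rT by simp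
      then have "cycle_dist ?N (\<phi> p ! i) (\<phi> r ! i) + cycle_dist ?N (\<phi> r ! i) (\<phi> q ! i) = cycle_dist ?N (\<phi> p ! i) (\<phi> q ! i)"
        using torus_dist_between im p q rT i by blast
      then have "cycle_dist ?N ?x (\<phi> r ! i) = 0" using p q by simp
      then have "\<phi> r ! i = ?x" using cycle_dist_eq_0[OF lt(1) torus_nth[OF im[OF rT] i]] by simp
      with rT show "r \<in> {v \<in> T. \<phi> v ! i = ?x}" by simp
    qed (use TV in auto)
    then have "co V E {x, y, z} \<subseteq> {v \<in> T. \<phi> v ! i = ?x}"
      by (rule co_least) (use xyz eq in auto)
    then have all: "\<And>v. v \<in> T \<Longrightarrow> \<phi> v ! i = ?x" using Tco by blast
    define c :: nat where "c = (if ?x = 0 then 1 else 0)"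
    then have c: "c < ?N" "c \<noteq> ?x" using N by auto
    then obtain v where "v \<in> T" "\<phi> v = (\<phi> x)[i := c]"
      using torus_update[OF im[OF xyz(1)] c(1)] \<phi> unfolding bij_betw_def by (metis imageE)
    moreover have "(\<phi> x)[i := c] ! i = c" using i torus_length[OF im[OF xyz(1)]] by simp
    ultimately show False using all c by metis
  qed
  have tr: "interval V E x y \<inter> interval V E x z = {x}" "interval V E y x \<inter> interval V E y z = {y}"
    "interval V E z x \<inter> interval V E z y = {z}"
    using tri unfolding metric_triangle_def by auto
  have cs: "cycle_dist ?N ?y ?x = cycle_dist ?N ?x ?y" "cycle_dist ?N ?z ?y = cycle_dist ?N ?y ?z" "cycle_dist ?N ?x ?z = cycle_dist ?N ?z ?x"
    by (rule cycle_dist_commute)+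
  note cx = corner_factor[OF T \<phi> d xyz(1,2,3) tr(1) i]
    and cy = corner_factor[OF T \<phi> d xyz(2,1,3) tr(2) i]
    and cz = corner_factor[OF T \<phi> d xyz(3,1,2) tr(3) i]
  have "?x = ?y \<and> ?x = ?z" if h: "cycle_dist ?N ?x ?y = cycle_dist ?N ?y ?z + cycle_dist ?N ?z ?x"
  proof -
    have "?z = ?x" by (rule cx[OF lt(3)]) (use h cs in simp_all)
    moreover have "?z = ?y" by (rule cy[OF lt(3)]) (use h cs in simp_all)
    ultimately show ?thesis by simp
  qed
  moreover have "?x = ?y \<and> ?x = ?z" if h: "cycle_dist ?N ?y ?z = cycle_dist ?N ?x ?y + cycle_dist ?N ?z ?x"
  proof -
    have "?x = ?y" by (rule cy[OF lt(1)]) (use h cs in simp_all)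
    moreover have "?x = ?z" by (rule cz[OF lt(1)]) (use h cs in simp_all)
    ultimately show ?thesis by simp
  qed
  moreover have "?x = ?y \<and> ?x = ?z" if h: "cycle_dist ?N ?z ?x = cycle_dist ?N ?x ?y + cycle_dist ?N ?y ?z"
  proof -
    have "?y = ?x" by (rule cx[OF lt(2)]) (use h cs in simp_all)
    moreover have "?y = ?z" by (rule cz[OF lt(2)]) (use h cs in simp_all)
    ultimately show ?thesis by simp
  qed
  ultimately have nd: "cycle_dist ?N ?x ?y \<noteq> cycle_dist ?N ?y ?z + cycle_dist ?N ?z ?x" "cycle_dist ?N ?y ?z \<noteq> cycle_dist ?N ?x ?y + cycle_dist ?N ?z ?x"
    "cycle_dist ?N ?z ?x \<noteq> cycle_dist ?N ?x ?y + cycle_dist ?N ?y ?z" using sp by blast+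
  then show per: "cycle_dist ?N ?x ?y + cycle_dist ?N ?y ?z + cycle_dist ?N ?z ?x = ?N"
    using cycle_dist_median_or_perimeter[OF lt] by linarith
  have le: "2 * cycle_dist ?N ?x ?y \<le> ?N" "2 * cycle_dist ?N ?y ?z \<le> ?N" "2 * cycle_dist ?N ?z ?x \<le> ?N"
    using cycle_dist_char lt by blast+
  then show str: "2 * cycle_dist ?N ?x ?y < ?N \<and> 2 * cycle_dist ?N ?y ?z < ?N \<and> 2 * cycle_dist ?N ?z ?x < ?N"
    using nd per by linarith
  obtain n where n: "?N = 2 * n" using N by blast
  \<comment> \<open>Three integers below \<open>n\<close> that add up to \<open>2 * n\<close>
    require \<open>n \<ge> 3\<close>.\<close>
  have "cycle_dist ?N ?x ?y < n" "cycle_dist ?N ?y ?z < n" "cycle_dist ?N ?z ?x < n" using str n by linarith+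
  then show "?N \<ge> 6" using per n by linarith
qed

section \<open>Retracts as isometric subgraphs\<close>

lemma retraction_gdist:
  assumes f: "retraction V E W f" and xy: "x \<in> W" "y \<in> W"
  shows "gdist W (induced E W) x y = gdist V E x y"
proof (rule antisym)
  have "gdist W (induced E W) (f x) (f y) \<le> gdist V E x y" "f x = x" "f y = y"
    using f xy unfolding retraction_def by blast+
  then show "gdist W (induced E W) x y \<le> gdist V E x y" by simp
  show "gdist V E x y \<le> gdist W (induced E W) x y"
    by (rule gdist_mono) (use f in \<open>simp add: retraction_def\<close>)
qed

lemma retraction_pcube: "retraction V E W f \<Longrightarrow> pcube W (induced E W) \<psi>"
  by (rule isometric_restrict) (auto simp: retraction_gdist, auto simp: retraction_def)

lemma retraction_hdist:
  assumes f: "retraction V E W f" and xy: "x \<in> V" "y \<in> V"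
  shows "hdist (f x) (f y) \<le> hdist x y"
proof -
  interpret W: pcube W "induced E W" \<psi> using retraction_pcube f .
  have "f x \<in> W" "f y \<in> W" "gdist W (induced E W) (f x) (f y) \<le> gdist V E x y"
    using f xy unfolding retraction_def by blast+
  then show ?thesis using W.gdist_hdist gdist_hdist xy by simp
qed

text \<open>Let \<open>\<pi>\<close> be the gate map of \<open>T\<close>. Then \<open>\<pi> \<circ> f\<close> maps the torus \<open>T\<close> to itself without
  increasing distances, its fixed points are those of \<open>T \<inter> W\<close>, and the corners are among them.\<close>

lemma hypertorus_in_retract:
  assumes f: "retraction V E W f" and T: "convex V E T" and \<phi>: "bij_betw \<phi> T (torus_verts ns)"
    and d: "\<forall>s\<in>T. \<forall>t\<in>T. hdist s t = torus_dist ns (\<phi> s) (\<phi> t)" and ns: "\<forall>n\<in>set ns. even n \<and> n \<ge> 4"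
    and gT: "gated T"
    and tri: "metric_triangle V E x y z" and Tco: "T = co V E {x, y, z}"
    and W: "x \<in> W" "y \<in> W" "z \<in> W"
  shows "T \<subseteq> W"
proof -
  interpret W: pcube W "induced E W" \<psi> using retraction_pcube f .
  have WV: "W \<subseteq> V" and fW: "\<And>v. v \<in> V \<Longrightarrow> f v \<in> W" and fid: "\<And>v. v \<in> W \<Longrightarrow> f v = v"
    using f unfolding retraction_def by blast+
  have TV: "T \<subseteq> V" using T by (simp add: convex_def)
  have xyz: "x \<in> T" "y \<in> T" "z \<in> T" unfolding Tco using co_superset[of "{x, y, z}"] by auto
  have im: "\<phi> u \<in> torus_verts ns" if "u \<in> T" for u using \<phi> that by (auto simp: bij_betw_def)
  have inj: "u = v" if "u \<in> T" "v \<in> T" "\<phi> u = \<phi> v" for u v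
    using \<phi> that by (auto simp: bij_betw_def inj_on_def)
  define \<rho> where "\<rho> = inv_into T \<phi>"
  have \<rho>: "\<rho> p \<in> T" "\<phi> (\<rho> p) = p" if "p \<in> torus_verts ns" for p
    using \<phi> that unfolding \<rho>_def bij_betw_def by (metis inv_into_into, metis f_inv_into_f)
  have \<rho>\<phi>: "\<rho> (\<phi> t) = t" if "t \<in> T" for t using \<rho>[OF im[OF that]] inj that by blast
  have "\<forall>u\<in>V. \<exists>p\<in>T. \<forall>t\<in>T. btw u p t" using gT unfolding gated_def .
  then obtain \<pi> where \<pi>: "\<And>u. u \<in> V \<Longrightarrow> \<pi> u \<in> T" "\<And>u t. u \<in> V \<Longrightarrow> t \<in> T \<Longrightarrow> btw u (\<pi> u) t" by metis
  have \<pi>id: "\<pi> t = t" if t: "t \<in> T" for t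
  proof -
    have tV: "t \<in> V" "\<pi> t \<in> V" using t TV \<pi>(1) by blast+
    have "btw t (\<pi> t) t" using \<pi>(2) t tV by blast
    then have "\<psi> (\<pi> t) = \<psi> t" unfolding btw_def by blast
    then show ?thesis using psi_inj tV by blast
  qed
  \<comment> \<open>A coordinate separating two gates crosses \<open>T\<close>, and there gates copy
    their points.\<close>
  have \<pi>d: "hdist (\<pi> u) (\<pi> v) \<le> hdist u v" if uv: "u \<in> V" "v \<in> V" for u v
    unfolding hdist_def
  proof (rule card_mono[OF fin[OF uv]], rule subsetI)
    fix e assume "e \<in> symdiff (\<psi> (\<pi> u)) (\<psi> (\<pi> v))"
    then have ne: "(e \<in> \<psi> (\<pi> u)) \<noteq> (e \<in> \<psi> (\<pi> v))" by (simp add: symdiff_iff)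
    then have c: "crosses T e" unfolding crosses_def using \<pi>(1) uv by blast
    have "e \<in> \<psi> (\<pi> u) \<longleftrightarrow> e \<in> \<psi> u" "e \<in> \<psi> (\<pi> v) \<longleftrightarrow> e \<in> \<psi> v"
      using gate_iff[OF \<pi>(1)] \<pi>(2) uv c by blast+
    with ne show "e \<in> symdiff (\<psi> u) (\<psi> v)" by (simp add: symdiff_iff)
  qed
  define g where "g p = \<phi> (\<pi> (f (\<rho> p)))" for p
  define F where "F = \<phi> ` (T \<inter> W)"
  have fV: "f v \<in> V" if "v \<in> V" for v using fW[OF that] WV by blast
  have \<pi>f: "\<pi> (f v) \<in> T" if "v \<in> T" for v using \<pi>(1) fV TV that by blast
  \<comment> \<open>If \<open>t\<close> is the gate of \<open>f t\<close>, it lies between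
    \<open>f t\<close> and the corner \<open>x\<close>; but \<open>f\<close> fixes \<open>x\<close>,
    so \<open>f t\<close> is no farther from \<open>x\<close> than \<open>t\<close> is.\<close>
  have fixed: "f t = t" if t: "t \<in> T" "\<pi> (f t) = t" for t
  proof -
    have V: "t \<in> V" "x \<in> V" "f t \<in> V" using t xyz TV fV by blast+
    have "hdist (f t) x \<le> hdist t x" using retraction_hdist[OF f V(1,2)] fid[OF W(1)] by simp
    moreover have "btw (f t) t x" using \<pi>(2)[OF V(3) xyz(1)] t(2) by simp
    then have "hdist (f t) t + hdist t x = hdist (f t) x" using btw_iff_hdist V by blast
    ultimately have "hdist (f t) t = 0" by simp
    then show ?thesis using hdist_eq_0 V by blast
  qed
  have factors: "ns ! i \<ge> 6" "even (ns ! i)" if "i < length ns" for i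
    using triangle_factors(3)[OF T \<phi> d ns tri Tco that] ns that by auto
  interpret torus_map ns g F
  proof
    show "even (ns ! i) \<and> 6 \<le> ns ! i" if "i < length ns" for i using factors[OF that] by simp
    show "g p \<in> torus_verts ns" if "p \<in> torus_verts ns" for p
      unfolding g_def using im \<pi>f \<rho>(1)[OF that] by blast
    show "torus_dist ns (g p) (g q) \<le> torus_dist ns p q" if p: "p \<in> torus_verts ns" and q: "q \<in> torus_verts ns" for p q
    proof -
      have T2: "\<rho> p \<in> T" "\<rho> q \<in> T" using \<rho>(1) p q by auto
      then have V: "\<rho> p \<in> V" "\<rho> q \<in> V" using TV by auto
      have "torus_dist ns (g p) (g q) = hdist (\<pi> (f (\<rho> p))) (\<pi> (f (\<rho> q)))" unfolding g_def using d \<pi>f T2 by simp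
      also have "\<dots> \<le> hdist (f (\<rho> p)) (f (\<rho> q))" using \<pi>d fV V by blast
      also have "\<dots> \<le> hdist (\<rho> p) (\<rho> q)" using retraction_hdist[OF f V] .
      also have "\<dots> = torus_dist ns p q" using d T2 \<rho>(2) p q by simp
      finally show ?thesis .
    qed
    show "p \<in> F \<longleftrightarrow> p \<in> torus_verts ns \<and> g p = p" for p
    proof
      assume "p \<in> F"
      then obtain t where "t \<in> T" "t \<in> W" "p = \<phi> t" unfolding F_def by blast
      then show "p \<in> torus_verts ns \<and> g p = p" using im \<rho>\<phi> fid \<pi>id by (simp add: g_def)
    next
      assume h: "p \<in> torus_verts ns \<and> g p = p"
      then have t: "\<rho> p \<in> T" "\<phi> (\<rho> p) = p" using \<rho> by auto
      have "\<phi> (\<pi> (f (\<rho> p))) = \<phi> (\<rho> p)" using h t by (simp add: g_def)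
      then have "\<pi> (f (\<rho> p)) = \<rho> p" using inj \<pi>f t by blast
      then have "\<rho> p \<in> W" using fixed t(1) fW TV by (metis subsetD)
      then show "p \<in> F" unfolding F_def using t by (metis IntI image_eqI)
    qed
    show "\<exists>r\<in>F. torus_dist ns p r = 1 \<and> torus_dist ns p q = Suc (torus_dist ns r q)" if pq: "p \<in> F" "q \<in> F" "p \<noteq> q" for p q
    proof -
      obtain s t where st: "s \<in> T" "s \<in> W" "p = \<phi> s" "t \<in> T" "t \<in> W" "q = \<phi> t"
        using pq unfolding F_def by blast
      then have "s \<noteq> t" using pq by blast
      obtain r where r: "induced E W s r" "r \<in> W" "hdist s t = Suc (hdist r t)" "btw s r t"
        by (rule W.geodesic_step[OF st(2,5) \<open>s \<noteq> t\<close>])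
      have "r \<in> T" using T st r WV unfolding convex_btw by blast
      moreover have "hdist s r = 1" using r(1) W.edge_hdist by blast
      ultimately have "\<phi> r \<in> F" "torus_dist ns p (\<phi> r) = 1" "torus_dist ns p q = Suc (torus_dist ns (\<phi> r) q)"
        using d st r unfolding F_def by auto
      then show ?thesis by blast
    qed
    \<comment> \<open>\<open>f\<close> keeps the point between \<open>s\<close> and
      \<open>t\<close>, so it stays in the convex set \<open>T\<close> and the gate map does not
      move it.\<close>
    show "g (g r) = g r" if h: "p \<in> F" "q \<in> F" "r \<in> torus_verts ns" "torus_dist ns p r + torus_dist ns r q = torus_dist ns p q" for p q r
    proof -
      obtain s t where st: "s \<in> T" "s \<in> W" "p = \<phi> s" "t \<in> T" "t \<in> W" "q = \<phi> t"
        using h unfolding F_def by blast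
      have r: "\<rho> r \<in> T" "\<phi> (\<rho> r) = r" using \<rho> h(3) by auto
      have V: "s \<in> V" "t \<in> V" "\<rho> r \<in> V" "f (\<rho> r) \<in> V" using st r TV fV by auto
      have "torus_dist ns (\<phi> s) (\<phi> (\<rho> r)) + torus_dist ns (\<phi> (\<rho> r)) (\<phi> t) = torus_dist ns (\<phi> s) (\<phi> t)" using h(4) st r by simp
      then have "hdist s (\<rho> r) + hdist (\<rho> r) t = hdist s t" using d st(1,4) r(1) by simp
      moreover have "hdist s (f (\<rho> r)) \<le> hdist s (\<rho> r)" "hdist (f (\<rho> r)) t \<le> hdist (\<rho> r) t"
        using retraction_hdist[OF f V(1,3)] retraction_hdist[OF f V(3,2)] fid st by simp_all
      ultimately have "hdist s (f (\<rho> r)) + hdist (f (\<rho> r)) t = hdist s t"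
        using hdist_triangle[OF V(1,2,4)] by linarith
      then have "btw s (f (\<rho> r)) t" using btw_iff_hdist V by blast
      then have "f (\<rho> r) \<in> T" using T st V(4) unfolding convex_btw by blast
      moreover have "f (\<rho> r) \<in> W" using fW V by blast
      ultimately show ?thesis using \<pi>id \<rho>\<phi> fid by (simp add: g_def)
    qed
  qed
  have "\<phi> x \<in> F" "\<phi> y \<in> F" "\<phi> z \<in> F" unfolding F_def using xyz W by auto
  then have "torus_verts ns \<subseteq> F"
    by (rule fixed_all) (use triangle_factors[OF T \<phi> d ns tri Tco] in auto)
  then have "\<phi> t \<in> \<phi> ` (T \<inter> W)" if "t \<in> T" for t using im[OF that] unfolding F_def by blast
  then show ?thesis using inj by blast
qed

text \<open>The metric triangle condition is left out on purpose: retractions can be seen to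
  preserve these equations alone, so the minimal triple is sought among their solutions.\<close>

definition qeq :: "'a \<Rightarrow> 'a \<Rightarrow> 'a \<Rightarrow> 'a \<Rightarrow> 'a \<Rightarrow> 'a \<Rightarrow> bool" where
  "qeq u v w x y z \<longleftrightarrow> hdist u v = hdist u x + hdist x y + hdist y v \<and>
     hdist v w = hdist v y + hdist y z + hdist z w \<and> hdist w u = hdist w z + hdist z x + hdist x u"

lemma quasi_median_hdist:
  assumes "u \<in> V" "v \<in> V" "w \<in> V"
  shows "quasi_median V E u v w x y z \<longleftrightarrow> metric_triangle V E x y z \<and> qeq u v w x y z"
proof (cases "metric_triangle V E x y z")
  case True
  then have "x \<in> V" "y \<in> V" "z \<in> V" by (auto simp: metric_triangle_def)
  with assms True show ?thesis by (simp add: quasi_median_def qeq_def gdist_hdist)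
qed (simp add: quasi_median_def)

lemma is_median_btw:
  assumes "u \<in> V" "v \<in> V" "w \<in> V"
  shows "is_median V E u v w m \<longleftrightarrow> m \<in> V \<and> btw u m v \<and> btw v m w \<and> btw w m u"
  using assms by (auto simp: is_median_def interval_btw)

lemma qeq_quasi_btw:
  assumes "u \<in> V" "v \<in> V" "w \<in> V" "x \<in> V" "y \<in> V" "z \<in> V" "qeq u v w x y z"
  shows "quasi_btw u v w x y z"
proof -
  have p: "btw a c b \<and> btw a e b"
    if "a \<in> V" "b \<in> V" "c \<in> V" "e \<in> V" "hdist a b = hdist a c + hdist c e + hdist e b" for a b c e
    using that hdist_triangle[of a b c] hdist_triangle[of a b e] hdist_triangle[of c b e] hdist_triangle[of a e c]
      btw_iff_hdist[of a b c] btw_iff_hdist[of a b e] by linarith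
  show ?thesis
    using p[of u v x y] p[of v w y z] p[of w u z x] assms unfolding qeq_def quasi_btw_def by blast
qed

text \<open>Convexity in \<open>W\<close> gives convexity in \<open>V\<close> here because the hull
  in \<open>W\<close> lies inside the hull in \<open>V\<close>, whose intervals stay in
  \<open>W\<close>.\<close>

lemma co_retract:
  assumes f: "retraction V E W f" and S: "S \<subseteq> W" and T: "co V E S \<subseteq> W"
  shows "co W (induced E W) S = co V E S"
proof -
  interpret W: pcube W "induced E W" \<psi> using retraction_pcube f .
  have WV: "W \<subseteq> V" using f by (simp add: retraction_def)
  have cT: "convex V E (co V E S)" using convex_co S WV by blast
  then have "convex W (induced E W) (co V E S)" using T WV unfolding convex_btw W.convex_btw by blast
  then have sub: "co W (induced E W) S \<subseteq> co V E S" using W.co_least co_superset by blast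
  have cW: "convex W (induced E W) (co W (induced E W) S)" using W.convex_co S by blast
  have "convex V E (co W (induced E W) S)"
    unfolding convex_btw
  proof (intro conjI ballI impI)
    show "co W (induced E W) S \<subseteq> V" using sub T WV by blast
    fix p q r assume h: "p \<in> co W (induced E W) S" "q \<in> co W (induced E W) S" "r \<in> V" "btw p r q"
    then have "r \<in> co V E S" using sub cT unfolding convex_btw by blast
    then have "r \<in> W" using T by blast
    with h cW show "r \<in> co W (induced E W) S" unfolding W.convex_btw by blast
  qed
  then have "co V E S \<subseteq> co W (induced E W) S" using co_least W.co_superset by blast
  with sub show ?thesis by blast
qed

text \<open>\<open>f\<close> maps a geodesic with both ends in \<open>W\<close> to one between the
  same ends.\<close>

lemma retract_median:
  assumes f: "retraction V E W f" and uvw: "u \<in> W" "v \<in> W" "w \<in> W"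
    and m: "m \<in> V" "btw u m v" "btw v m w" "btw w m u"
  shows "\<exists>m\<in>W. btw u m v \<and> btw v m w \<and> btw w m u"
proof -
  have WV: "W \<subseteq> V" and fm: "f m \<in> W" and fid: "\<And>v. v \<in> W \<Longrightarrow> f v = v"
    using f m(1) unfolding retraction_def by blast+
  have b: "btw a (f m) b" if ab: "a \<in> W" "b \<in> W" "btw a m b" for a b
  proof -
    have V: "a \<in> V" "b \<in> V" "f m \<in> V" using ab fm WV by auto
    have "hdist a (f m) \<le> hdist a m" "hdist (f m) b \<le> hdist m b"
      using retraction_hdist[OF f V(1) m(1)] retraction_hdist[OF f m(1) V(2)] fid ab by simp_all
    moreover have "hdist a m + hdist m b = hdist a b" using btw_iff_hdist[OF V(1,2) m(1)] ab(3) by blast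
    ultimately have "hdist a (f m) + hdist (f m) b = hdist a b" using hdist_triangle[OF V] by linarith
    then show ?thesis using btw_iff_hdist[OF V] by blast
  qed
  with fm uvw m show ?thesis by blast
qed

text \<open>Among the triples of \<open>W\<close> satisfying the quasi-median equations of \<open>(u, v, w)\<close>, one of minimal
  perimeter coincides with its own hyper-median in the whole graph.\<close>

lemma retract_corners:
  assumes f: "retraction V E W f" and uvw: "u \<in> W" "v \<in> W" "w \<in> W"
    and hm: "\<And>u v w. u \<in> V \<Longrightarrow> v \<in> V \<Longrightarrow> w \<in> V \<Longrightarrow>
      (\<exists>m. is_median V E u v w m) \<or> (\<exists>x y z. hyper_median V E u v w x y z)"
    and nm: "\<not> (\<exists>m\<in>W. btw u m v \<and> btw v m w \<and> btw w m u)"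
  shows "\<exists>x\<in>W. \<exists>y\<in>W. \<exists>z\<in>W. qeq u v w x y z \<and> hyper_median V E x y z x y z"
proof -
  have WV: "W \<subseteq> V" and fW: "\<And>v. v \<in> V \<Longrightarrow> f v \<in> W" and fid: "\<And>v. v \<in> W \<Longrightarrow> f v = v"
    using f unfolding retraction_def by blast+
  define P where "P = (\<lambda>(x, y, z). x \<in> W \<and> y \<in> W \<and> z \<in> W \<and> qeq u v w x y z)"
  define per where "per = (\<lambda>(x, y, z). hdist x y + hdist y z + hdist z x)"
  have "P (u, v, w)" using uvw by (simp add: P_def qeq_def)
  then obtain t where t: "P t" "\<And>s. P s \<Longrightarrow> per t \<le> per s"
    using ex_has_least_nat[of P "(u, v, w)" per] by blast
  obtain x y z where txyz: "t = (x, y, z)" by (cases t)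
  have xyz: "x \<in> W" "y \<in> W" "z \<in> W" and q: "qeq u v w x y z" using t(1) by (auto simp: txyz P_def)
  have V: "u \<in> V" "v \<in> V" "w \<in> V" "x \<in> V" "y \<in> V" "z \<in> V" using uvw xyz WV by auto
  note qb = qeq_quasi_btw[OF V q]
  \<comment> \<open>A median of the triple would lie in the intervals of \<open>u\<close>,
    \<open>v\<close>, \<open>w\<close> as well, and \<open>f\<close> would bring it into
    \<open>W\<close>.\<close>
  have "\<not> is_median V E x y z m" for m
  proof
    assume "is_median V E x y z m"
    then have m: "m \<in> V" "btw x m y" "btw y m z" "btw z m x" using is_median_btw[OF V(4-6)] by blast+
    have tr: "btw a m b" if "btw a c b" "btw a d b" "btw c m d" for a b c d
      using that unfolding btw_def by blast
    have "btw u m v" "btw v m w" "btw w m u" using qb m(2-4) tr unfolding quasi_btw_def by blast+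
    with retract_median[OF f uvw m(1)] nm show False by blast
  qed
  with hm[OF V(4-6)] obtain x' y' z' where h: "hyper_median V E x y z x' y' z'" by blast
  then have "quasi_median V E x y z x' y' z'" by (simp add: hyper_median_def)
  then have q': "qeq x y z x' y' z'" and tri: "metric_triangle V E x' y' z'"
    using quasi_median_hdist[OF V(4-6)] by blast+
  have V': "x' \<in> V" "y' \<in> V" "z' \<in> V" using tri by (auto simp: metric_triangle_def)
  have fV: "f x' \<in> V" "f y' \<in> V" "f z' \<in> V" using fW V' WV by blast+
  \<comment> \<open>None of the three pieces of the chain grows under \<open>f\<close>, and their
    total cannot shrink, so all lengths are kept.\<close>
  have chain: "hdist a (f c) + hdist (f c) (f e) + hdist (f e) b = hdist a b \<and> hdist (f c) (f e) = hdist c e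
      \<and> hdist a (f c) = hdist a c \<and> hdist (f e) b = hdist e b"
    if "a \<in> W" "b \<in> W" "c \<in> V" "e \<in> V" "hdist a b = hdist a c + hdist c e + hdist e b" for a b c e
  proof -
    have W: "a \<in> V" "b \<in> V" "f c \<in> V" "f e \<in> V" using that WV fW by blast+
    have "hdist a (f c) \<le> hdist a c" "hdist (f c) (f e) \<le> hdist c e" "hdist (f e) b \<le> hdist e b"
      using retraction_hdist[OF f W(1) that(3)] retraction_hdist[OF f that(3,4)]
        retraction_hdist[OF f that(4) W(2)] fid that(1,2) by simp_all
    then show ?thesis
      using that(5) hdist_triangle[OF W(1,2,3)] hdist_triangle[OF W(3,2,4)] by linarith
  qed
  have e: "hdist x y = hdist x x' + hdist x' y' + hdist y' y" "hdist y z = hdist y y' + hdist y' z' + hdist z' z"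
    "hdist z x = hdist z z' + hdist z' x' + hdist x' x"
    using q' by (simp_all add: qeq_def)
  note c = chain[OF xyz(1,2) V'(1,2) e(1)] chain[OF xyz(2,3) V'(2,3) e(2)] chain[OF xyz(3,1) V'(3,1) e(3)]
  have join: "hdist a b = hdist a c' + hdist c' e' + hdist e' b"
    if "hdist a b = hdist a c + hdist c e + hdist e b" "hdist c c' + hdist c' e' + hdist e' e = hdist c e"
      "a \<in> V" "b \<in> V" "c \<in> V" "e \<in> V" "c' \<in> V" "e' \<in> V" for a b c e c' e'
    using that(1,2) hdist_triangle[OF that(3,7,5)] hdist_triangle[OF that(8,4,6)]
      hdist_triangle[OF that(3,4,7)] hdist_triangle[OF that(7,4,8)] by linarith
  have "qeq u v w (f x') (f y') (f z')"
    unfolding qeq_def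
    using q c V fV join[of u v x y "f x'" "f y'"] join[of v w y z "f y'" "f z'"] join[of w u z x "f z'" "f x'"]
    unfolding qeq_def by blast
  then have "P (f x', f y', f z')" using fW V' by (simp add: P_def)
  \<comment> \<open>The image triple has the perimeter of \<open>x'\<close>, \<open>y'\<close>,
    \<open>z'\<close>, which falls short of that of \<open>x\<close>, \<open>y\<close>,
    \<open>z\<close> by twice the three distances between corresponding corners. Minimality makes
    them vanish.\<close>
  from t(2)[OF this] have "hdist x y + hdist y z + hdist z x \<le> hdist x' y' + hdist y' z' + hdist z' x'"
    using c by (simp add: per_def txyz)
  with e have "hdist x x' = 0" "hdist y y' = 0" "hdist z z' = 0" by linarith+
  then have "x' = x" "y' = y" "z' = z" using hdist_eq_0 V V' by auto
  with h q xyz show ?thesis by blast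
qed

text \<open>The hypertorus serves twice: lying in \<open>W\<close>, it makes the triple a
  hyper-median of \<open>W\<close>, and being gated and antipodal it feeds the Peano criterion. A
  coordinate on which \<open>x\<close>, \<open>y\<close>, \<open>z\<close> agree is constant on
  their hull, hence does not cross it.\<close>

lemma retract_triple:
  assumes f: "retraction V E W f" and uvw: "u \<in> W" "v \<in> W" "w \<in> W"
    and ph: "\<And>A. finite A \<Longrightarrow> convex V E A \<Longrightarrow> ph_le A (induced E A) 1"
    and hm: "\<And>u v w. u \<in> V \<Longrightarrow> v \<in> V \<Longrightarrow> w \<in> V \<Longrightarrow>
      (\<exists>m. is_median V E u v w m) \<or> (\<exists>x y z. hyper_median V E u v w x y z)"
    and nm: "\<not> (\<exists>m\<in>W. btw u m v \<and> btw v m w \<and> btw w m u)"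
  shows "\<exists>x y z T. hyper_median W (induced E W) u v w x y z \<and> T \<subseteq> W \<and> antipodal T \<and> gated T \<and>
    x \<in> T \<and> y \<in> T \<and> z \<in> T \<and> quasi_btw u v w x y z \<and>
    (\<forall>e. crosses T e \<longrightarrow> \<not> ((e \<in> \<psi> x \<longleftrightarrow> e \<in> \<psi> y) \<and> (e \<in> \<psi> x \<longleftrightarrow> e \<in> \<psi> z)))"
proof -
  interpret W: pcube W "induced E W" \<psi> using retraction_pcube f .
  have WV: "W \<subseteq> V" using f by (simp add: retraction_def)
  obtain x y z where xyz: "x \<in> W" "y \<in> W" "z \<in> W" and q: "qeq u v w x y z"
    and h: "hyper_median V E x y z x y z"
    using retract_corners[OF f uvw hm nm] by blast
  have V: "u \<in> V" "v \<in> V" "w \<in> V" "x \<in> V" "y \<in> V" "z \<in> V" using uvw xyz WV by auto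
  define T where "T = co V E {x, y, z}"
  have tri: "metric_triangle V E x y z" using h by (simp add: hyper_median_def quasi_median_def)
  have "hypertorus T (induced E T)" using h by (simp add: hyper_median_def T_def)
  then obtain ns \<phi> where ns: "\<forall>n\<in>set ns. even n \<and> n \<ge> 4" and \<phi>: "bij_betw \<phi> T (torus_verts ns)"
    and adj: "\<forall>x\<in>T. \<forall>y\<in>T. induced E T x y \<longleftrightarrow> torus_adj ns (\<phi> x) (\<phi> y)"
    unfolding hypertorus_def by (elim conjE exE) rule
  have T: "convex V E T" unfolding T_def by (rule convex_co) (use V in simp)
  have finT: "finite T" unfolding T_def by (rule finite_co[of _ x]) (use V in auto)
  have xT: "x \<in> T" "y \<in> T" "z \<in> T" unfolding T_def using co_superset[of "{x, y, z}"] by auto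
  have n2: "\<forall>n\<in>set ns. n \<ge> 2" using ns by fastforce
  have d: "\<forall>s\<in>T. \<forall>t\<in>T. hdist s t = torus_dist ns (\<phi> s) (\<phi> t)"
    using hypertorus_hdist[OF T \<phi> _ n2] adj by blast
  have anti: "antipodal T" using hypertorus_antipodal[OF T \<phi> d] ns by blast
  have gT: "gated T" using antipodal_gated[OF ph T finT anti] xT by blast
  have TW: "T \<subseteq> W" using hypertorus_in_retract[OF f T \<phi> d ns gT tri T_def xyz] .
  have co: "co W (induced E W) {x, y, z} = T"
    using co_retract[OF f, of "{x, y, z}"] xyz TW unfolding T_def by blast
  have ind: "induced (induced E W) T = induced E T" using TW by (auto simp: induced_def fun_eq_iff)
  have iW: "interval W (induced E W) a b = interval V E a b \<inter> W" if "a \<in> W" "b \<in> W" for a b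
    using W.interval_btw[OF that] interval_btw[of a b] that WV by blast
  have "metric_triangle W (induced E W) x y z"
    using tri xyz unfolding metric_triangle_def by (simp add: iW) blast
  then have "quasi_median W (induced E W) u v w x y z" using W.quasi_median_hdist[OF uvw] q by blast
  then have hW: "hyper_median W (induced E W) u v w x y z"
    unfolding hyper_median_def co ind using h by (simp add: hyper_median_def T_def)
  have "\<not> ((e \<in> \<psi> x \<longleftrightarrow> e \<in> \<psi> y) \<and> (e \<in> \<psi> x \<longleftrightarrow> e \<in> \<psi> z))" if "crosses T e" for e
  proof
    assume "(e \<in> \<psi> x \<longleftrightarrow> e \<in> \<psi> y) \<and> (e \<in> \<psi> x \<longleftrightarrow> e \<in> \<psi> z)"
    then have "e \<in> \<psi> s \<longleftrightarrow> e \<in> \<psi> x" if "s \<in> T" for s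
      using co_agree[of "{x, y, z}" e "e \<in> \<psi> x" s] V that unfolding T_def by blast
    with that show False unfolding crosses_def by blast
  qed
  with hW TW anti gT xT qeq_quasi_btw[OF V q] show ?thesis by blast
qed

end

theorem theorem6p10:
  fixes V W :: "'a set" and E :: "'a \<Rightarrow> 'a \<Rightarrow> bool"
  assumes "hyper_median_partial_cube V E"
    and "retract V E W"
  shows "hyper_median_partial_cube W (induced E W)"
proof -
  obtain f where f: "retraction V E W f" using assms(2) unfolding retract_def by blast
  have pc: "partial_cube V E" and ph: "\<And>A. finite A \<Longrightarrow> convex V E A \<Longrightarrow> ph_le A (induced E A) 1"
    and hm: "\<And>u v w. u \<in> V \<Longrightarrow> v \<in> V \<Longrightarrow> w \<in> V \<Longrightarrow>
      (\<exists>m. is_median V E u v w m) \<or> (\<exists>x y z. hyper_median V E u v w x y z)"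
    using assms(1) unfolding hyper_median_partial_cube_def peano_partial_cube_def by blast+
  obtain \<psi> :: "'a \<Rightarrow> ('a \<times> 'a) set" where \<psi>: "pcube V E \<psi>"
    using pc unfolding partial_cube_def pcube_def symdiff_def by blast
  interpret pcube V E \<psi> by (rule \<psi>)
  interpret W: pcube W "induced E W" \<psi> using retraction_pcube f .
  have WV: "W \<subseteq> V" using f by (simp add: retraction_def)
  note triple = retract_triple[OF f _ _ _ ph hm]
  have "W.peano_axiom"
  proof (rule W.peano_axiomI)
    fix u v w assume uvw: "u \<in> W" "v \<in> W" "w \<in> W"
    \<comment> \<open>Gates are now demanded only for points of \<open>W\<close>, and the gates
      found in \<open>V\<close> serve.\<close>
    have "W.gated T" if "gated T" for T using that WV unfolding gated_def W.gated_def by blast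
    with triple[OF uvw] show "(\<exists>m\<in>W. btw u m v \<and> btw v m w \<and> btw w m u) \<or>
        (\<exists>x y z T. T \<subseteq> W \<and> antipodal T \<and> W.gated T \<and> x \<in> T \<and> y \<in> T \<and> z \<in> T \<and> quasi_btw u v w x y z \<and>
          (\<forall>e. crosses T e \<longrightarrow> \<not> ((e \<in> \<psi> x \<longleftrightarrow> e \<in> \<psi> y) \<and> (e \<in> \<psi> x \<longleftrightarrow> e \<in> \<psi> z))))"
      by blast
  qed
  then have "ph_le A (induced (induced E W) A) 1" if "convex W (induced E W) A" for A
    using W.peano_ph_le that by blast
  moreover have "partial_cube W (induced E W)"
    unfolding partial_cube_def
  proof (intro conjI exI[of _ \<psi>])
    show "graph W (induced E W)" by (rule W.gr)
    show "\<forall>x\<in>W. \<forall>y\<in>W. finite (\<psi> x - \<psi> y \<union> (\<psi> y - \<psi> x)) \<and>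
        gdist W (induced E W) x y = enat (card (\<psi> x - \<psi> y \<union> (\<psi> y - \<psi> x)))"
      using W.fin W.gd unfolding symdiff_def by blast
  qed
  moreover have "(\<exists>m. is_median W (induced E W) u v w m) \<or> (\<exists>x y z. hyper_median W (induced E W) u v w x y z)"
    if uvw: "u \<in> W" "v \<in> W" "w \<in> W" for u v w
    using triple[OF uvw] W.is_median_btw[OF uvw] by blast
  ultimately show ?thesis
    unfolding hyper_median_partial_cube_def peano_partial_cube_def by blast
qed

end
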